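(* Let $k\ge3$ and let $V\in\mathbb{Q}[\lambda][x_1,\dots,x_d]$ be homogeneous of degree $k$ in $\boldsymbol{x}=(x_1,\dots,x_d)$. Denote $M=\tfrac{k}{k-2}$ and $K=\tfrac{2}{k-2}$. Then, for any integer $n\ge0$ such that $nK,nM\in\mathbb{Z}$, we have $$A_n^V(\lambda)=\frac{2^{nM+(d-2)/2}\left(nM+\frac{d-2}{2}\right)!}{(2\pi)^{d/2}\,(nK)!}\int_{S^{d-1}}V(\boldsymbol{x},\lambda)^{nK}\,\omega_{S^{d-1}},$$ where $\omega_{S^{d-1}}$ denotes the standard volume form of the $(d-1)$-dimensional unit sphere $S^{d-1}\subset\mathbb{R}^d$.
   Context: **Graphs.** Graphs are finite, self-loops and multiple edges are allowed, graphs need not be connected, and each edge carries one of $d$ colours. Formally, given disjoint finite sets $H_1,\dots,H_d$ of half-edge labels, a half-edge labelled coloured graph $\Gamma=(V,E_{H_1},\dots,E_{H_d})$ consists of a set partition $V$ of $H_1\sqcup\dots\sqcup H_d$ (the vertices) and, for each $i$, a set partition $E_{H_i}$ of $H_i$ into blocks of size two (the edges of colour $i$). An isomorphism is a tuple of bijections $j_i:H_i\to H'_i$ mapping $E_{H_i}$ to $E'_{H'_i}$ for each $i$ and, jointly, mapping $V$ to $V'$. An edge-coloured graph $G$ is an isomorphism class, and $|\mathrm{Aut}(G)|$ is the number of automorphisms of a representative. $V_G$, $E_G$ are the sets of vertices and edges; the degree of $v\in V_G$ is $\deg(v)=(|v\cap H_1|,\dots,|v\cap H_d|)\in\mathbb{Z}^d_{\ge0}$.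 $\mathcal{G}_{-n}$ is the set of isomorphism classes with Euler characteristic $\chi(G)=|V_G|-|E_G|=-n$ (the empty graph is allowed). **The polynomial $A_n^V$.** Write $V(\boldsymbol{x},\lambda)=\sum_{\boldsymbol{w}\in\mathbb{Z}^d_{\ge0},\,|\boldsymbol{w}|\ge1}\Lambda_{\boldsymbol{w}}(\lambda)\frac{\boldsymbol{x}^{\boldsymbol{w}}}{\boldsymbol{w}!}$ with $\boldsymbol{w}!=w_1!\cdots w_d!$, $\boldsymbol{x}^{\boldsymbol{w}}=x_1^{w_1}\cdots x_d^{w_d}$, $|\boldsymbol{w}|=w_1+\dots+w_d$. Then $A_n^V(\lambda)=\sum_{G\in\mathcal{G}_{-n}}\frac{1}{|\mathrm{Aut}(G)|}\prod_{v\in V_G}\Lambda_{\deg(v)}(\lambda)$. The factorial of a half-integer is $a!=\Gamma(a+1)$. *)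

theory Defs
  imports
    "HOL-Analysis.Analysis"
    "HOL-Computational_Algebra.Polynomial"
    "HOL-Library.Poly_Mapping"
    "HOL-Library.Disjoint_Sets"
    "HOL-Library.FuncSet"
begin

section \<open>Edge-coloured graphs\<close>

text \<open>
  Half-edge labels have type \<open>'h\<close>, colours have the finite type \<open>'c\<close>; the number of colours
  is \<open>d = CARD('c)\<close>.
\<close>

datatype ('h, 'c) cgraph =
  CGraph (half_edges: "'c \<Rightarrow> 'h set") (verts: "'h set set") (edges: "'c \<Rightarrow> 'h set set")

definition wf_cgraph :: "('h, 'c::finite) cgraph \<Rightarrow> bool" where
  "wf_cgraph G \<longleftrightarrow>
     (\<forall>i. finite (half_edges G i)) \<and>
     disjoint_family (half_edges G) \<and>
     partition_on (\<Union>i. half_edges G i) (verts G) \<and>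
     (\<forall>i. partition_on (half_edges G i) (edges G i) \<and> (\<forall>e\<in>edges G i. card e = 2))"

text \<open>
  The maps \<open>j i\<close> are required to be extensional (undefined off \<open>half_edges G i\<close>), so that
  counting isomorphisms counts tuples of bijections between the label sets.
\<close>

definition cgraph_isos ::
  "('h, 'c::finite) cgraph \<Rightarrow> ('k, 'c) cgraph \<Rightarrow> ('c \<Rightarrow> 'h \<Rightarrow> 'k) set" where
  "cgraph_isos G G' =
     {j. (\<forall>i. j i \<in> extensional (half_edges G i) \<and>
              bij_betw (j i) (half_edges G i) (half_edges G' i) \<and>
              (\<lambda>e. j i ` e) ` edges G i = edges G' i) \<and>
         (\<lambda>v. \<Union>i. j i ` (v \<inter> half_edges G i)) ` verts G = verts G'}"

definition cgraph_aut_card :: "('h, 'c::finite) cgraph \<Rightarrow> nat" where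
  "cgraph_aut_card G = card (cgraph_isos G G)"

definition euler_char :: "('h, 'c::finite) cgraph \<Rightarrow> int" where
  "euler_char G = int (card (verts G)) - int (card (\<Union>i. edges G i))"

definition vdeg :: "('h, 'c::finite) cgraph \<Rightarrow> 'h set \<Rightarrow> 'c \<Rightarrow> nat" where
  "vdeg G v i = card (v \<inter> half_edges G i)"

text \<open>
  Every graph is isomorphic to one with labels in \<^typ>\<open>nat\<close>, so isomorphism classes are taken
  among those.
\<close>

definition cgraph_rel :: "((nat, 'c::finite) cgraph \<times> (nat, 'c) cgraph) set" where
  "cgraph_rel = {(G, G'). wf_cgraph G \<and> wf_cgraph G' \<and> cgraph_isos G G' \<noteq> {}}"

definition edge_coloured_graphs :: "int \<Rightarrow> (nat, 'c::finite) cgraph set set" where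
  "edge_coloured_graphs c = {G. wf_cgraph G \<and> euler_char G = c} // cgraph_rel"

definition repr :: "(nat, 'c::finite) cgraph set \<Rightarrow> (nat, 'c) cgraph" where
  "repr C = (SOME G. G \<in> C)"


section \<open>Polynomials and the graph sum\<close>

text \<open>
  An element of \<open>\<rat>[\<lambda>][x\<^sub>1, \<dots>, x\<^sub>d]\<close>: a finitely supported map from exponent vectors to \<open>\<rat>[\<lambda>]\<close>.
\<close>

type_synonym 'c mvpoly = "('c \<Rightarrow>\<^sub>0 nat) \<Rightarrow>\<^sub>0 rat poly"

definition homogeneous :: "nat \<Rightarrow> ('c::finite) mvpoly \<Rightarrow> bool" where
  "homogeneous k V \<longleftrightarrow>
     (\<forall>m \<in> Poly_Mapping.keys V. (\<Sum>i\<in>UNIV. Poly_Mapping.lookup m i) = k)"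

definition eval_lam :: "rat poly \<Rightarrow> real \<Rightarrow> real" where
  "eval_lam p lam = poly (map_poly of_rat p) lam"

definition eval_mvpoly :: "('c::finite) mvpoly \<Rightarrow> real ^ 'c \<Rightarrow> real \<Rightarrow> real" where
  "eval_mvpoly V x lam =
     (\<Sum>m\<in>Poly_Mapping.keys V.
        eval_lam (Poly_Mapping.lookup V m) lam * (\<Prod>i\<in>UNIV. (x $ i) ^ Poly_Mapping.lookup m i))"

text \<open>
  \<open>\<Lambda>\<^sub>w\<close> is \<open>w!\<close> times the coefficient of \<open>x\<^sup>w\<close>. As \<open>'c\<close> is finite, \<^const>\<open>Abs_poly_mapping\<close>
  is a genuine coercion here: every function has finite support.
\<close>

definition Lam :: "('c::finite) mvpoly \<Rightarrow> ('c \<Rightarrow> nat) \<Rightarrow> rat poly" where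
  "Lam V w =
     smult (of_nat (\<Prod>i\<in>UNIV. fact (w i))) (Poly_Mapping.lookup V (Abs_poly_mapping w))"

definition graph_weight :: "('c::finite) mvpoly \<Rightarrow> (nat, 'c) cgraph \<Rightarrow> rat poly" where
  "graph_weight V G =
     smult (1 / of_nat (cgraph_aut_card G)) (\<Prod>v\<in>verts G. Lam V (vdeg G v))"

text \<open>
  There are infinitely many graphs of a given Euler characteristic, so the sum is taken over
  those contributing a nonzero term. There are finitely many of these if \<open>V\<close> is homogeneous of
  degree at least three, since then the degrees fix the number of vertices.
\<close>

definition A_poly :: "nat \<Rightarrow> ('c::finite) mvpoly \<Rightarrow> rat poly" where
  "A_poly n V =
     (\<Sum>C \<in> {C \<in> edge_coloured_graphs (- int n). graph_weight V (repr C) \<noteq> 0}.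
        graph_weight V (repr C))"


section \<open>Factorials and the volume of the sphere\<close>

definition gamma_fact :: "real \<Rightarrow> real" where
  "gamma_fact a = Gamma (a + 1)"

text \<open>
  The measure on the unit sphere given by its standard volume form: the volume of \<open>A\<close> is \<open>d\<close>
  times the Lebesgue measure of the cone \<open>{r u | 0 < r < 1, u \<in> A}\<close>. This is the measure
  \<open>\<sigma>\<close> for which Lebesgue measure is \<open>r\<^bsup>d-1\<^esup> dr d\<sigma>(u)\<close> in polar coordinates. For \<open>d = 1\<close> it is
  counting measure on \<open>{-1, 1}\<close>, and its total mass is \<open>2 \<pi>\<^bsup>d/2\<^esup> / \<Gamma>(d/2)\<close>.
\<close>

definition sphere_measure :: "'a::euclidean_space measure" where
  "sphere_measure =
     scale_measure (ennreal (real DIM('a)))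
       (distr (restrict_space lborel (ball 0 1 - {0})) (restrict_space borel (sphere 0 1))
          (\<lambda>x. x /\<^sub>R norm x))"

lemma measurable_sphere_proj:
  "(\<lambda>x::'a::euclidean_space. x /\<^sub>R norm x) \<in>
     restrict_space lborel (ball 0 1 - {0}) \<rightarrow>\<^sub>M restrict_space borel (sphere 0 1)"
  by (rule measurable_restrict_space2) (auto simp: space_restrict_space intro!: measurable_restrict_space1)

lemma space_sphere_measure [simp]: "space (sphere_measure :: 'a::euclidean_space measure) = sphere 0 1"
  by (simp add: sphere_measure_def space_restrict_space space_scale_measure)

lemma sets_sphere_measure [simp, measurable_cong]:
  "sets (sphere_measure :: 'a::euclidean_space measure) = sets (restrict_space borel (sphere 0 1))"
  by (simp add: sphere_measure_def)

lemma emeasure_sphere_measure: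
  assumes "A \<in> sets (restrict_space borel (sphere (0::'a::euclidean_space) 1))"
  shows "emeasure sphere_measure A =
           ennreal (real DIM('a)) *
             emeasure lborel {x \<in> ball 0 1 - {0}. x /\<^sub>R norm x \<in> A}"
proof -
  have "(\<lambda>x. x /\<^sub>R norm x) -` A \<inter> (ball 0 1 - {0}) = {x \<in> ball 0 1 - {0}. x /\<^sub>R norm x \<in> A}"
    by auto
  then show ?thesis
    using assms
    by (simp add: sphere_measure_def emeasure_distr[OF measurable_sphere_proj]
        space_restrict_space del: mem_ball_0) (subst emeasure_restrict_space; force)
qed

lemma emeasure_sphere_measure_total:
  "emeasure sphere_measure (sphere (0::'a::euclidean_space) 1) =
     ennreal (2 * pi powr (real DIM('a) / 2) / Gamma (real DIM('a) / 2))"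
proof -
  let ?d = "real DIM('a)"
  have S: "sphere (0::'a) 1 \<in> sets (restrict_space borel (sphere 0 1))"
    using sets.top[of "restrict_space borel (sphere (0::'a) 1)"] by (simp add: space_restrict_space)
  have "{x \<in> ball 0 1 - {0}. x /\<^sub>R norm x \<in> sphere (0::'a) 1} = ball 0 1 - {0}"
    by auto
  then have "emeasure sphere_measure (sphere (0::'a) 1) = ennreal ?d * emeasure lborel (ball (0::'a) 1 - {0})"
    by (simp only: emeasure_sphere_measure[OF S])
  also have "emeasure lborel (ball (0::'a) 1 - {0}) = emeasure lborel (ball (0::'a) 1)"
    by (rule emeasure_Diff_null_set) auto
  also have "\<dots> = ennreal (unit_ball_vol ?d)"
    by (simp add: emeasure_ball)
  also have "ennreal ?d * ennreal (unit_ball_vol ?d) = ennreal (?d * unit_ball_vol ?d)"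
    by (simp add: ennreal_mult)
  also have "?d * unit_ball_vol ?d = 2 * pi powr (?d / 2) / Gamma (?d / 2)"
  proof -
    have "Gamma (?d / 2 + 1) = ?d / 2 * Gamma (?d / 2)"
      by (rule Gamma_plus1) (use DIM_positive[where ?'a = 'a] in \<open>auto dest!: nonpos_Ints_nonpos\<close>)
    then have "?d * unit_ball_vol ?d = ?d * (pi powr (?d / 2) / (?d / 2 * Gamma (?d / 2)))"
      by (simp only: unit_ball_vol_def)
    then show ?thesis
      by simp
  qed
  finally show ?thesis .
qed

end

theory Submission
  imports Defs "HOL-Probability.Distributions"
begin

text \<open>
  Both sides equal \<open>E[V(X)\<^sup>N] / N!\<close> for a standard Gaussian vector \<open>X\<close> and \<open>N = nK\<close>.
  As \<open>V\<close> is homogeneous, \<open>V(X)\<^sup>N\<close> has degree \<open>kN = 2nM\<close>, and polar coordinates turn its expectation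
  into the sphere integral times a radial integral, which is the Gamma factor.
  On the other side, a graph contributing to \<open>A\<^sub>n\<close> has all degrees among the exponents of \<open>V\<close>, hence
  \<open>N\<close> vertices. Numbering its vertices, and the half-edges of each colour at each vertex, makes it a
  choice of \<open>N\<close> monomials of \<open>V\<close> and of a pairing of the half-edges of each colour. A graph \<open>G\<close> has
  \<open>N! \<Prod>\<^sub>v deg(v)! / |Aut(G)|\<close> such presentations, and the number of pairings of an \<open>s\<close>-element set is
  the \<open>s\<close>-th moment of the standard normal distribution.
\<close>

section \<open>Moments of the sphere measure\<close>

text \<open>No random vector is built. The comparison runs monomial by monomial: both sides expand
  over the maps \<open>f\<close> from \<open>{..<N}\<close> to the exponents of \<open>V\<close>,
  and for each \<open>f\<close> both carry the product over the colours \<open>i\<close> of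
  \<open>std_moment\<close> at the number of half-edges of colour \<open>i\<close>. Integrating x^s
  exp(-|x|^2/2) in Cartesian and in polar coordinates gives the sphere moment of x^s. The radial
  factor 2^(z-1) Gamma(z), z = (|s|+d)/2, is common to all terms because |s| = kN throughout; (2
  pi)^(d/2) is the mass of the unnormalised Gaussian. The obstacle on the graph side is that graphs
  have symmetries, so choices of monomials and pairings do not correspond to classes one by one. No
  group action is used: pairs (standard graph, isomorphism onto it) are counted twice, once by
  graphs, with |Aut| isomorphisms each, and once by isomorphisms. The second count is free of
  symmetry, since an isomorphism onto a standard graph determines its target. The factorials deg(v)!
  that it yields are those contained in \<open>Lam\<close>, which leaves the bare coefficients of
  \<open>V\<close>.\<close>

lemma nn_integral_sphere_measure:
  fixes g :: "'a::euclidean_space \<Rightarrow> ennreal"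
  assumes [measurable]: "g \<in> borel_measurable borel"
  shows "(\<integral>\<^sup>+u. g u \<partial>sphere_measure) =
    ennreal (real DIM('a)) * (\<integral>\<^sup>+x. g (x /\<^sub>R norm x) * indicator (ball 0 1) x \<partial>lborel)"
proof -
  have g: "g \<in> borel_measurable (restrict_space borel (sphere 0 1))"
    by (rule measurable_restrict_space1) measurable
  have "(\<integral>\<^sup>+x. g x \<partial>distr (restrict_space lborel (ball 0 1 - {0}))
          (restrict_space borel (sphere 0 1)) (\<lambda>x. x /\<^sub>R norm x)) =
        (\<integral>\<^sup>+x. g (x /\<^sub>R norm x) * indicator (ball 0 1 - {0}) x \<partial>lborel)"
    by (subst nn_integral_distr[OF measurable_sphere_proj], use g in simp,
        subst nn_integral_restrict_space) auto
  \<comment> \<open>The direction is meaningless at the origin only; that point is a null set, so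
    the full ball may be used.\<close>
  also have "\<dots> = (\<integral>\<^sup>+x. g (x /\<^sub>R norm x) * indicator (ball 0 1) x \<partial>lborel)"
    using AE_lborel_singleton[of "0::'a"]
    by (intro nn_integral_cong_AE, elim eventually_mono) (auto simp: indicator_def)
  finally show ?thesis
    unfolding sphere_measure_def using g by (subst nn_integral_scale_measure) auto
qed

text \<open>The direction x/|x| is unchanged by x -> R x, so this substitution only rescales the
  ball and leaves the Jacobian R^d.\<close>

lemma nn_integral_scaled_ball:
  fixes g :: "'a::euclidean_space \<Rightarrow> ennreal"
  assumes [measurable]: "g \<in> borel_measurable borel" and R: "R > 0"
  shows "(\<integral>\<^sup>+x. g (x /\<^sub>R norm x) * indicator (ball 0 R) x \<partial>lborel) =
    ennreal (R ^ DIM('a)) * (\<integral>\<^sup>+x. g (x /\<^sub>R norm x) * indicator (ball 0 1) x \<partial>lborel)"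
proof -
  have [measurable]: "Measurable.pred borel (\<lambda>x::'a. x \<in> ball 0 r)" for r
    by simp
  have "(\<integral>\<^sup>+x. g (x /\<^sub>R norm x) * indicator (ball 0 R) x \<partial>lborel) =
    (\<integral>\<^sup>+x. g (x /\<^sub>R norm x) * indicator (ball 0 R) x
       \<partial>density (distr lborel borel (\<lambda>x. 0 + R *\<^sub>R x)) (\<lambda>_. \<bar>R\<bar> ^ DIM('a)))"
    using R by (subst lborel_affine[of R "0::'a"]) auto
  also have "\<dots> = (\<integral>\<^sup>+x. ennreal (R ^ DIM('a)) *
      (g ((R *\<^sub>R x) /\<^sub>R norm (R *\<^sub>R x)) * indicator (ball 0 R) (R *\<^sub>R x)) \<partial>lborel)"
    using R by (subst nn_integral_density; (subst nn_integral_distr)?) (auto simp: power_abs)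
  also have "\<dots> = (\<integral>\<^sup>+x. ennreal (R ^ DIM('a)) *
      (g (x /\<^sub>R norm x) * indicator (ball 0 1) x) \<partial>lborel)"
    using R by (intro nn_integral_cong) (auto simp: indicator_def field_simps)
  finally show ?thesis
    by (simp add: nn_integral_cmult)
qed

lemma nn_integral_power_Ioo:
  assumes "n > 0" "R > (0::real)"
  shows "(\<integral>\<^sup>+r. ennreal (r ^ (n - 1)) * indicator {0<..<R} r \<partial>lborel) = ennreal (R ^ n / real n)"
proof -
  have "(\<integral>\<^sup>+r. ennreal (r ^ (n - 1)) * indicator {0<..<R} r \<partial>lborel) =
        (\<integral>\<^sup>+r. ennreal (r ^ (n - 1)) * indicator {0..R} r \<partial>lborel)"
    using AE_lborel_singleton[of "0::real"] AE_lborel_singleton[of R]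
    by (intro nn_integral_cong_AE, eventually_elim) (auto simp: indicator_def)
  also have "\<dots> = ennreal (R ^ n / real n - 0 ^ n / real n)"
    using assms
    by (intro nn_integral_FTC_Icc) (auto intro!: derivative_eq_intros simp: field_simps)
  finally show ?thesis using assms by (simp add: power_0_left)
qed

text \<open>Both sides, as functionals of \<open>\<phi>\<close>, are measures on the half-line that agree on all \<open>{0<..<R}\<close>
  by scaling; the push-forward under \<open>\<lambda>x. - norm x\<close> turns these intervals into rays \<open>{-R<..}\<close>.\<close>

lemma nn_integral_polar:
  fixes g :: "'a::euclidean_space \<Rightarrow> ennreal" and \<phi> :: "real \<Rightarrow> ennreal"
  assumes g[measurable]: "g \<in> borel_measurable borel" and [measurable]: "\<phi> \<in> borel_measurable borel"
    and fin: "(\<integral>\<^sup>+u. g u \<partial>sphere_measure) < \<infinity>"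
  shows "(\<integral>\<^sup>+x. g (x /\<^sub>R norm x) * \<phi> (norm x) \<partial>lborel) =
    (\<integral>\<^sup>+u. g u \<partial>sphere_measure) *
    (\<integral>\<^sup>+r. \<phi> r * ennreal (r ^ (DIM('a) - 1)) * indicator {0<..} r \<partial>lborel)"
proof -
  let ?n = "DIM('a)"
  define S where "S = (\<integral>\<^sup>+u. g u \<partial>sphere_measure)"
  define c where "c = (\<integral>\<^sup>+x. g (x /\<^sub>R norm x) * indicator (ball 0 1) x \<partial>lborel)"
  have Sc: "S = ennreal (real ?n) * c"
    unfolding S_def c_def by (rule nn_integral_sphere_measure) fact
  define M where "M = distr (density lborel (\<lambda>x::'a. g (x /\<^sub>R norm x))) borel (\<lambda>x. - norm x)"
  define N where "N = distr (density lborel (\<lambda>r::real. S * (ennreal (r ^ (?n - 1)) * indicator {0<..} r)))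
                        borel uminus"
  have vim: "(\<lambda>y::'a. - norm y) -` {x<..} = ball 0 (- x)" for x
    by auto
  have vim': "uminus -` {x<..} = {..<- x}" for x :: real
    by auto
  have M: "emeasure M {x<..} = (\<integral>\<^sup>+y. g (y /\<^sub>R norm y) * indicator (ball 0 (-x)) y \<partial>lborel)" for x
    unfolding M_def
    by (subst emeasure_distr, simp, simp, subst emeasure_density)
       (auto intro!: nn_integral_cong simp: indicator_def vim)
  have N: "emeasure N {x<..} =
      S * (\<integral>\<^sup>+r. ennreal (r ^ (?n - 1)) * indicator {0<..<-x} r \<partial>lborel)" for x
    unfolding N_def
    by (subst emeasure_distr, simp, simp, subst emeasure_density)
       (auto intro!: nn_integral_cong simp: indicator_def vim' simp flip: nn_integral_cmult)
  have MN: "emeasure M {x<..} = ennreal ((-x) ^ ?n) * c \<and> emeasure N {x<..} = ennreal ((-x) ^ ?n) * c"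
    if "x < 0" for x
  proof
    show "emeasure M {x<..} = ennreal ((-x) ^ ?n) * c"
      unfolding M c_def using that by (intro nn_integral_scaled_ball) auto
    have "emeasure N {x<..} = S * ennreal ((-x) ^ ?n / ?n)"
      unfolding N using that by (subst nn_integral_power_Ioo) auto
    also have "\<dots> = ennreal (real ?n) * ennreal ((-x) ^ ?n / ?n) * c"
      by (simp add: Sc mult_ac)
    also have "ennreal (real ?n) * ennreal ((-x) ^ ?n / ?n) = ennreal ((-x) ^ ?n)"
      using that by (subst ennreal_mult[symmetric]) auto
    finally show "emeasure N {x<..} = ennreal ((-x) ^ ?n) * c" .
  qed
  have MN0: "emeasure M {x<..} = 0 \<and> emeasure N {x<..} = 0" if "\<not> x < 0" for x
    unfolding M N using that by (simp add: ball_empty)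
  \<comment> \<open>Uniqueness of a measure from its values on rays needs these values finite;
    \<open>fin\<close> supplies this, as \<open>S\<close> is a positive multiple of
    \<open>c\<close>.\<close>
  have "c < \<infinity>"
  proof -
    have "c \<noteq> \<infinity>"
      using fin Sc unfolding S_def by (auto simp: ennreal_mult_top)
    then show ?thesis by (simp add: top.not_eq_extremum)
  qed
  then have "emeasure M {x<..} < \<infinity>" for x
    using MN[of x] MN0[of x] by (cases "x < 0") (auto simp: ennreal_mult_less_top)
  moreover have "emeasure M {x<..} = emeasure N {x<..}" for x
    using MN[of x] MN0[of x] by (cases "x < 0") auto
  ultimately have "M = N"
    by (intro measure_eqI_lessThan) (auto simp: M_def N_def)
  have "(\<integral>\<^sup>+x. g (x /\<^sub>R norm x) * \<phi> (norm x) \<partial>lborel) = (\<integral>\<^sup>+r. \<phi> (-r) \<partial>M)"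
    unfolding M_def by (subst nn_integral_distr; (subst nn_integral_density)?) simp_all
  also have "\<dots> = (\<integral>\<^sup>+r. \<phi> (-r) \<partial>N)" by (simp add: \<open>M = N\<close>)
  also have "\<dots> = (\<integral>\<^sup>+r. S * (ennreal (r ^ (?n - 1)) * indicator {0<..} r) * \<phi> r \<partial>lborel)"
    unfolding N_def by (subst nn_integral_distr; (subst nn_integral_density)?) simp_all
  also have "\<dots> = S * (\<integral>\<^sup>+r. \<phi> r * ennreal (r ^ (?n - 1)) * indicator {0<..} r \<partial>lborel)"
    by (subst nn_integral_cmult[symmetric]) (auto intro!: nn_integral_cong simp: mult_ac)
  finally show ?thesis unfolding S_def .
qed

section \<open>Radial moments of the Gaussian weight\<close>

lemma Gamma_nat_plus_half:
  "Gamma (real k + 1 / 2) = sqrt pi * fact (2 * k) / (2 ^ (2 * k) * fact k)"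
proof (induction k)
  case 0
  then show ?case by (simp add: Gamma_one_half_real)
next
  case (Suc k)
  have "Gamma (real k + 1 / 2 + 1) = (real k + 1 / 2) * Gamma (real k + 1 / 2)"
    by (rule Gamma_plus1) (auto dest!: nonpos_Ints_nonpos)
  also have "real k + 1 / 2 + 1 = real (Suc k) + 1 / 2" by simp
  finally have eq: "Gamma (real (Suc k) + 1 / 2) = (real k + 1 / 2) * Gamma (real k + 1 / 2)" .
  \<comment> \<open>The factor k + 1/2 is exposed in (2k + 2)(2k + 1) to match the one from the
    functional equation of Gamma.\<close>
  have "fact (2 * Suc k) = (2 * (real k + 1)) * (2 * (real k + 1 / 2)) * fact (2 * k)"
    by (simp add: algebra_simps)
  moreover have "fact (Suc k) = (real k + 1) * fact k"
    by (simp add: algebra_simps)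
  moreover have "real k + 1 \<noteq> 0" by linarith
  moreover have "(2::real) ^ (2 * Suc k) = 4 * 2 ^ (2 * k)" by simp
  ultimately show ?case
    unfolding eq Suc.IH by (simp only:) (simp add: divide_simps, simp add: algebra_simps)
qed

text \<open>The half-line moments of exp(-r^2) are known separately for even and odd
  \<open>a\<close>; a single Gamma value covers both, so that the parity of S + d never matters
  later.\<close>

lemma nn_integral_power_gauss_aux:
  "(\<integral>\<^sup>+r. ennreal (r ^ a * exp (- r\<^sup>2)) * indicator {0<..} r \<partial>lborel) =
    ennreal (Gamma ((real a + 1) / 2) / 2)"
proof -
  have "has_bochner_integral lborel (\<lambda>x::real. indicator {0..} x *\<^sub>R (exp (-x\<^sup>2) * x ^ a))
          (Gamma ((real a + 1) / 2) / 2)"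
  proof (cases "even a")
    case True
    then obtain k where k: "a = 2 * k" by blast
    have "(real a + 1) / 2 = real k + 1 / 2" by (simp add: k)
    then have "Gamma ((real a + 1) / 2) / 2 = (sqrt pi / 2) * (fact (2 * k) / (2 ^ (2 * k) * fact k))"
      by (simp only: Gamma_nat_plus_half) simp
    then show ?thesis
      using gaussian_moment_even_pos[of k] by (simp only: k)
  next
    case False
    then obtain k where k: "a = 2 * k + 1" by (blast elim: oddE)
    have "(real a + 1) / 2 = 1 + real k" by (simp add: k)
    then have "Gamma ((real a + 1) / 2) / 2 = fact k / 2"
      by (simp only: Gamma_fact)
    then show ?thesis
      using gaussian_moment_odd_pos[of k] by (simp only: k)
  qed
  then have "(\<integral>\<^sup>+r. ennreal (indicator {0..} r *\<^sub>R (exp (- r\<^sup>2) * r ^ a)) \<partial>lborel) =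
      ennreal (Gamma ((real a + 1) / 2) / 2)"
    by (subst nn_integral_eq_integral) (auto simp: has_bochner_integral_iff indicator_def)
  moreover have "(\<integral>\<^sup>+r. ennreal (r ^ a * exp (- r\<^sup>2)) * indicator {0<..} r \<partial>lborel) =
      (\<integral>\<^sup>+r. ennreal (indicator {0..} r *\<^sub>R (exp (- r\<^sup>2) * r ^ a)) \<partial>lborel)"
    using AE_lborel_singleton[of "0::real"]
    by (intro nn_integral_cong_AE, eventually_elim) (auto simp: indicator_def mult.commute)
  ultimately show ?thesis by simp
qed

text \<open>Substituting r = sqrt 2 * t turns the weight into exp(-t^2).\<close>

lemma nn_integral_power_gauss:
  "(\<integral>\<^sup>+r. ennreal (r ^ a * exp (- r\<^sup>2 / 2)) * indicator {0<..} r \<partial>lborel) =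
    ennreal (2 powr ((real a - 1) / 2) * Gamma ((real a + 1) / 2))"
proof -
  \<comment> \<open>sqrt 2 ^ a comes from the power, sqrt 2 from the substitution, 1/2 from the
    half-line moment.\<close>
  have p: "sqrt 2 ^ a * sqrt 2 / 2 = 2 powr ((real a - 1) / 2)"
  proof -
    have "sqrt 2 = 2 powr (1 / 2)" by (simp add: powr_half_sqrt)
    then have "sqrt 2 ^ a * sqrt 2 = 2 powr (real a / 2 + 1 / 2)"
      by (simp add: powr_add powr_power)
    also have "\<dots> = 2 powr ((real a - 1) / 2 + 1)" by (simp add: field_simps)
    finally show ?thesis by (simp add: powr_add)
  qed
  have G: "Gamma ((real a + 1) / 2) \<ge> 0"
    by (simp add: Gamma_real_pos less_imp_le)
  have "(\<integral>\<^sup>+r. ennreal (r ^ a * exp (- r\<^sup>2 / 2)) * indicator {0<..} r \<partial>lborel) =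
    ennreal (sqrt 2) * (\<integral>\<^sup>+r. ennreal ((sqrt 2 * r) ^ a * exp (- (sqrt 2 * r)\<^sup>2 / 2)) *
       indicator {0<..} (sqrt 2 * r) \<partial>lborel)"
    by (subst nn_integral_real_affine[of _ "sqrt 2" 0]) auto
  also have "(\<integral>\<^sup>+r. ennreal ((sqrt 2 * r) ^ a * exp (- (sqrt 2 * r)\<^sup>2 / 2)) *
       indicator {0<..} (sqrt 2 * r) \<partial>lborel) =
       (\<integral>\<^sup>+r. ennreal (sqrt 2 ^ a) * (ennreal (r ^ a * exp (- r\<^sup>2)) * indicator {0<..} r) \<partial>lborel)"
    by (intro nn_integral_cong)
       (auto simp: indicator_def power_mult_distrib ennreal_mult[symmetric] zero_less_mult_iff mult_ac)
  also have "\<dots> = ennreal (sqrt 2 ^ a) * ennreal (Gamma ((real a + 1) / 2) / 2)"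
    by (subst nn_integral_cmult) (auto simp: nn_integral_power_gauss_aux)
  also have "ennreal (sqrt 2) * \<dots> = ennreal ((sqrt 2 ^ a * sqrt 2 / 2) * Gamma ((real a + 1) / 2))"
    using G by (simp add: ennreal_mult[symmetric] mult_ac)
  finally show ?thesis unfolding p .
qed

text \<open>For even \<open>s\<close> this is the double factorial (s - 1)!!, with value 1 at
  \<open>s = 0\<close>.\<close>

definition std_moment :: "nat \<Rightarrow> real" where
  "std_moment s = (if even s then fact s / (2 ^ (s div 2) * fact (s div 2)) else 0)"

lemma std_moment_nonneg: "std_moment s \<ge> 0"
  by (simp add: std_moment_def)

section \<open>The Gaussian integral in Cartesian and in polar coordinates\<close>

lemma nn_integral_even_power_gauss:
  assumes "even s"
  shows "(\<integral>\<^sup>+x. ennreal (x ^ s * exp (- x\<^sup>2 / 2)) \<partial>lborel) = ennreal (sqrt (2 * pi) * std_moment s)"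
proof -
  obtain k where k: "s = 2 * k" using assms by blast
  have "has_bochner_integral lborel (\<lambda>x. sqrt (2 * pi) * (normal_density 0 1 x * (x - 0) ^ (2 * k)))
      (sqrt (2 * pi) * (fact (2 * k) / ((2 / 1\<^sup>2) ^ k * fact k)))"
    by (intro has_bochner_integral_mult_right normal_moment_even) auto
  also have "(\<lambda>x. sqrt (2 * pi) * (normal_density 0 1 x * (x - 0) ^ (2 * k))) =
      (\<lambda>x. x ^ s * exp (- x\<^sup>2 / 2))"
    by (auto simp: normal_density_def k mult_ac)
  finally have *: "has_bochner_integral lborel (\<lambda>x. x ^ s * exp (- x\<^sup>2 / 2)) (sqrt (2 * pi) * std_moment s)"
    using assms by (simp add: std_moment_def k)
  have "(\<integral>\<^sup>+x. ennreal (x ^ s * exp (- x\<^sup>2 / 2)) \<partial>lborel) =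
      ennreal (integral\<^sup>L lborel (\<lambda>x. x ^ s * exp (- x\<^sup>2 / 2)))"
    using * assms by (intro nn_integral_eq_integral) (auto simp: has_bochner_integral_iff zero_le_even_power)
  with * show ?thesis by (simp add: has_bochner_integral_iff)
qed

lemma nn_integral_lborel_vec_prod:
  fixes F :: "'c::finite \<Rightarrow> real \<Rightarrow> ennreal"
  assumes "\<And>i. F i \<in> borel_measurable borel"
  shows "(\<integral>\<^sup>+x. (\<Prod>i\<in>UNIV. F i (x $ i)) \<partial>(lborel :: (real ^ 'c) measure)) =
    (\<Prod>i\<in>UNIV. \<integral>\<^sup>+x. F i x \<partial>lborel)"
proof -
  have inj: "inj (\<lambda>i::'c. axis i (1::real))"
    by (auto simp: inj_on_def axis_eq_axis)
  have B: "(Basis :: (real^'c) set) = (\<lambda>i. axis i 1) ` UNIV"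
    by (auto simp: Basis_vec_def)
  have P: "(\<Prod>b\<in>(Basis :: (real^'c) set). h b) = (\<Prod>i\<in>UNIV. h (axis i 1))" for h :: "_ \<Rightarrow> ennreal"
    unfolding B by (subst prod.reindex[OF inj]) simp
  have "(\<integral>\<^sup>+x. (\<Prod>b\<in>Basis. F (axis_index b) (x \<bullet> b)) \<partial>(lborel :: (real ^ 'c) measure)) =
     (\<Prod>b\<in>(Basis :: (real ^ 'c) set). \<integral>\<^sup>+x. F (axis_index b) x \<partial>lborel)"
    by (rule nn_integral_lborel_prod) (use assms in auto)
  then show ?thesis
    unfolding P by (simp add: inner_axis)
qed

lemma abs_monomial_le_1:
  fixes x :: "real ^ 'c::finite"
  assumes "norm x \<le> 1"
  shows "\<bar>\<Prod>i\<in>UNIV. (x $ i) ^ s i\<bar> \<le> 1"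
proof -
  have "\<bar>x $ i\<bar> \<le> 1" for i
    using component_le_norm_cart[of x i] assms by linarith
  then show ?thesis
    by (auto simp: abs_prod power_abs intro!: prod_le_1 power_le_one)
qed

text \<open>The integral of the monomial against exp(-|x|^2/2) over the whole space is evaluated in
  two ways. Even exponents keep the integrand nonnegative, so only finiteness of the sphere integral
  has to be checked.\<close>

lemma nn_integral_sphere_monomial:
  fixes s :: "'c::finite \<Rightarrow> nat"
  assumes "\<And>i. even (s i)"
  defines "S \<equiv> \<Sum>i\<in>UNIV. s i"
  shows "(\<integral>\<^sup>+x. ennreal (\<Prod>i\<in>UNIV. (x $ i) ^ s i) \<partial>(sphere_measure :: (real ^ 'c) measure)) *
      ennreal (2 powr ((real S + real CARD('c)) / 2 - 1) * Gamma ((real S + real CARD('c)) / 2)) =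
    ennreal ((2 * pi) powr (real CARD('c) / 2) * (\<Prod>i\<in>UNIV. std_moment (s i)))"
proof -
  let ?g = "\<lambda>x::real^'c. ennreal (\<Prod>i\<in>UNIV. (x $ i) ^ s i)"
  let ?\<phi> = "\<lambda>r. ennreal (r ^ S * exp (- r\<^sup>2 / 2))"
  have nonneg: "(\<Prod>i\<in>UNIV. (x $ i) ^ s i) \<ge> 0" for x :: "real^'c"
    using assms by (intro prod_nonneg) (auto simp: zero_le_even_power)
  have [measurable]: "?g \<in> borel_measurable borel"
    by measurable
  have "(\<integral>\<^sup>+x. ?g x \<partial>sphere_measure) \<le> (\<integral>\<^sup>+x. 1 \<partial>(sphere_measure :: (real ^ 'c) measure))"
  proof (rule nn_integral_mono)
    fix x :: "real^'c" assume "x \<in> space sphere_measure"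
    then have "\<bar>\<Prod>i\<in>UNIV. (x $ i) ^ s i\<bar> \<le> 1"
      by (intro abs_monomial_le_1) simp
    then show "?g x \<le> 1" by (simp add: ennreal_le_1)
  qed
  also have "\<dots> < \<infinity>"
    using emeasure_sphere_measure_total[where 'a = "real^'c"] by simp
  finally have fin: "(\<integral>\<^sup>+x. ?g x \<partial>sphere_measure) < \<infinity>" .
  have "(\<integral>\<^sup>+x. ?g (x /\<^sub>R norm x) * ?\<phi> (norm x) \<partial>lborel) =
    (\<integral>\<^sup>+x. (\<Prod>i\<in>UNIV. ennreal ((x $ i) ^ s i * exp (- (x $ i)\<^sup>2 / 2))) \<partial>lborel)"
  \<comment> \<open>The powers of |x| cancel only away from the origin.\<close>
  proof (rule nn_integral_cong_AE, use AE_lborel_singleton[of "0::real^'c"] in eventually_elim)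
    case (elim x)
    have "(\<Prod>i\<in>UNIV. exp (- (x $ i)\<^sup>2 / 2)) = exp (- (norm x)\<^sup>2 / 2)"
      by (simp add: exp_sum[symmetric] sum_negf sum_divide_distrib norm_vec_def L2_set_def sum_nonneg)
    have "?g (x /\<^sub>R norm x) * ?\<phi> (norm x) = ennreal (\<Prod>i\<in>UNIV. (x $ i) ^ s i * exp (- (x $ i)\<^sup>2 / 2))"
    proof -
      have "(\<Prod>i\<in>UNIV. ((x /\<^sub>R norm x) $ i) ^ s i) = (\<Prod>i\<in>UNIV. (x $ i) ^ s i) / norm x ^ S"
      proof -
        have "((x /\<^sub>R norm x) $ i) ^ s i = (x $ i) ^ s i / norm x ^ s i" for i
        proof -
          have "(x /\<^sub>R norm x) $ i = x $ i / norm x" by (simp add: divide_inverse mult.commute)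
          then show ?thesis by (simp add: power_divide)
        qed
        then show ?thesis by (simp only: prod_dividef S_def power_sum)
      qed
      then show ?thesis
        using elim nonneg[of "x /\<^sub>R norm x"] \<open>(\<Prod>i\<in>UNIV. exp (- (x $ i)\<^sup>2 / 2)) = _\<close>
        by (simp add: ennreal_mult[symmetric] prod.distrib)
    qed
    also have "\<dots> = (\<Prod>i\<in>UNIV. ennreal ((x $ i) ^ s i * exp (- (x $ i)\<^sup>2 / 2)))"
      using assms by (subst prod_ennreal) (auto simp: zero_le_even_power)
    finally show ?case .
  qed
  also have "\<dots> = (\<Prod>i\<in>UNIV. ennreal (sqrt (2 * pi) * std_moment (s i)))"
    by (subst nn_integral_lborel_vec_prod) (auto simp only: nn_integral_even_power_gauss[OF assms(1)], measurable)
  also have "\<dots> = ennreal (sqrt (2 * pi) ^ CARD('c) * (\<Prod>i\<in>UNIV. std_moment (s i)))"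
    by (subst prod_ennreal) (auto simp: prod.distrib std_moment_nonneg)
  also have "sqrt (2 * pi) ^ CARD('c) = (2 * pi) powr (real CARD('c) / 2)"
    using powr_half_sqrt[of "2 * pi"] by (simp add: powr_power flip: powr_half_sqrt)
  \<comment> \<open>The chain turns around: this rewrites the left side of the accumulated equation
    by polar coordinates, so that the two evaluations face each other.\<close>
  also have "(\<integral>\<^sup>+x. ?g (x /\<^sub>R norm x) * ?\<phi> (norm x) \<partial>lborel) = (\<integral>\<^sup>+u. ?g u \<partial>sphere_measure) *
    (\<integral>\<^sup>+r. ?\<phi> r * ennreal (r ^ (DIM(real^'c) - 1)) * indicator {0<..} r \<partial>lborel)"
    by (rule nn_integral_polar[OF _ _ fin]) auto
  also have "(\<integral>\<^sup>+r. ?\<phi> r * ennreal (r ^ (DIM(real^'c) - 1)) * indicator {0<..} r \<partial>lborel) =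
     (\<integral>\<^sup>+r. ennreal (r ^ (S + CARD('c) - 1) * exp (- r\<^sup>2 / 2)) * indicator {0<..} r \<partial>lborel)"
  proof (intro nn_integral_cong)
    fix r :: real
    \<comment> \<open>Truncated subtraction is harmless, as there is at least one colour. The
      exponent S + d - 1 leads to Gamma at (S + d)/2.\<close>
    have "S + (CARD('c) - 1) = S + CARD('c) - 1" using zero_less_card_finite[where 'a='c] by linarith
    then show "?\<phi> r * ennreal (r ^ (DIM(real^'c) - 1)) * indicator {0<..} r =
      ennreal (r ^ (S + CARD('c) - 1) * exp (- r\<^sup>2 / 2)) * indicator {0<..} r"
      by (cases "r > 0") (auto simp: ennreal_mult[symmetric] power_add[symmetric] mult_ac)
  qed
  also have "\<dots> = ennreal (2 powr ((real S + real CARD('c)) / 2 - 1) * Gamma ((real S + real CARD('c)) / 2))"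
  proof -
    have "real (S + CARD('c) - 1) = real S + real CARD('c) - 1" using zero_less_card_finite[where 'a='c] by linarith
    then show ?thesis unfolding nn_integral_power_gauss by (simp add: diff_divide_distrib)
  qed
  finally show ?thesis .
qed


section \<open>Signed monomials and odd exponents\<close>

lemma finite_measure_sphere: "finite_measure (sphere_measure :: 'a::euclidean_space measure)"
  by standard (simp add: emeasure_sphere_measure_total)

lemma integrable_sphere_monomial:
  fixes s :: "'c::finite \<Rightarrow> nat"
  shows "integrable (sphere_measure :: (real ^ 'c) measure) (\<lambda>x. \<Prod>i\<in>UNIV. (x $ i) ^ s i)"
proof -
  interpret finite_measure "sphere_measure :: (real ^ 'c) measure"
    by (rule finite_measure_sphere)
  show ?thesis
  proof (rule integrable_const_bound[where B = 1])
    show "AE x in sphere_measure. norm (\<Prod>i\<in>UNIV. ((x :: real ^ 'c) $ i) ^ s i) \<le> 1"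
      by (rule AE_I2) (auto intro!: abs_monomial_le_1)
    show "(\<lambda>x. \<Prod>i\<in>UNIV. (x $ i) ^ s i) \<in> borel_measurable (sphere_measure :: (real ^ 'c) measure)"
      by (subst measurable_cong_sets[OF sets_sphere_measure refl], rule measurable_restrict_space1) measurable
  qed
qed

text \<open>The reflection is diagonal with entries 1 and -1 in the standard basis, so its Jacobian
  factor is 1.\<close>

lemma lborel_distr_reflect:
  "distr lborel borel (\<lambda>x :: real ^ 'c::finite. \<chi> j. if j = i then - x $ j else x $ j) = lborel"
proof -
  define c :: "real ^ 'c \<Rightarrow> real" where "c b = (if b = axis i 1 then -1 else 1)" for b
  have T: "(\<lambda>x :: real ^ 'c. \<chi> j. if j = i then - x $ j else x $ j) =
      (\<lambda>x. 0 + (\<Sum>b\<in>Basis. (c b * (x \<bullet> b)) *\<^sub>R b))"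
  proof
    fix x :: "real ^ 'c"
    have "(\<Sum>b\<in>Basis. (c b * (x \<bullet> b)) *\<^sub>R b) \<bullet> b' = (\<chi> j. if j = i then - x $ j else x $ j) \<bullet> b'"
      if b: "b' \<in> Basis" for b'
    proof -
      obtain j where b': "b' = axis j 1" using b by (auto simp: Basis_vec_def)
      show ?thesis using b
        by (simp add: inner_sum_left_Basis) (simp add: b' c_def inner_axis axis_eq_axis)
    qed
    then show "(\<chi> j. if j = i then - x $ j else x $ j) = 0 + (\<Sum>b\<in>Basis. (c b * (x \<bullet> b)) *\<^sub>R b)"
      by (metis (no_types, lifting) add_0 euclidean_eqI)
  qed
  have "(\<Prod>b\<in>Basis. \<bar>c b\<bar>) = 1"
    by (intro prod.neutral) (auto simp: c_def)
  moreover have "(lborel :: (real^'c) measure) =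
      density (distr lborel borel (\<lambda>x. 0 + (\<Sum>b\<in>Basis. (c b * (x \<bullet> b)) *\<^sub>R b))) (\<lambda>_. (\<Prod>b\<in>Basis. \<bar>c b\<bar>))"
    by (rule lborel_affine_euclidean) (auto simp: c_def)
  ultimately show ?thesis unfolding T by (simp add: density_1)
qed

text \<open>A coordinate reflection preserves the norm and commutes with scaling, so the invariance
  of Lebesgue measure passes through the cone integral to the sphere.\<close>

lemma nn_integral_sphere_reflect:
  fixes g :: "real ^ 'c::finite \<Rightarrow> ennreal"
  assumes [measurable]: "g \<in> borel_measurable borel"
  shows "(\<integral>\<^sup>+x. g (\<chi> j. if j = i then - x $ j else x $ j) \<partial>sphere_measure) = (\<integral>\<^sup>+x. g x \<partial>sphere_measure)"
proof -
  define T where "T = (\<lambda>x :: real ^ 'c. \<chi> j. if j = i then - x $ j else x $ j)"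
  have norm: "norm (T x) = norm x" for x
  proof -
    have "(\<Sum>j\<in>UNIV. (norm (T x $ j))\<^sup>2) = (\<Sum>j\<in>UNIV. (norm (x $ j))\<^sup>2)"
      by (intro sum.cong) (auto simp: T_def)
    then show ?thesis by (simp add: norm_vec_def L2_set_def)
  qed
  have scale: "T (r *\<^sub>R x) = r *\<^sub>R T x" for r x
    by (simp add: T_def vec_eq_iff)
  have [measurable]: "T \<in> borel_measurable borel"
  proof -
    have "continuous_on UNIV (\<lambda>x::real^'c. if j = i then - x $ j else x $ j)" for j
      by (cases "j = i") (auto intro!: continuous_intros)
    then show ?thesis
      unfolding T_def by (intro borel_measurable_continuous_onI continuous_on_vec_lambda)
  qed
  have [measurable]: "Measurable.pred borel (\<lambda>x::real ^ 'c. x \<in> ball 0 1)"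
    by simp
  have "(\<integral>\<^sup>+x. g (x /\<^sub>R norm x) * indicator (ball 0 1) x \<partial>lborel) =
     (\<integral>\<^sup>+x. g (x /\<^sub>R norm x) * indicator (ball 0 1) x \<partial>distr lborel borel T)"
    unfolding T_def lborel_distr_reflect ..
  also have "\<dots> = (\<integral>\<^sup>+x. g (T (x /\<^sub>R norm x)) * indicator (ball 0 1) x \<partial>lborel)"
    by (subst nn_integral_distr) (auto intro!: nn_integral_cong simp: norm scale indicator_def)
  finally have "(\<integral>\<^sup>+x. g (T x) \<partial>sphere_measure) = (\<integral>\<^sup>+x. g x \<partial>sphere_measure)"
    by (simp add: nn_integral_sphere_measure)
  then show ?thesis by (simp add: T_def)
qed

text \<open>Reflecting the coordinate with odd exponent flips the sign of the monomial, so its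
  positive and negative parts have equal integrals.\<close>

lemma integral_sphere_monomial_odd:
  fixes s :: "'c::finite \<Rightarrow> nat"
  assumes "odd (s i)"
  shows "(\<integral>x. (\<Prod>i\<in>UNIV. (x $ i) ^ s i) \<partial>(sphere_measure :: (real ^ 'c) measure)) = 0"
proof -
  have neg: "(\<Prod>k\<in>UNIV. ((\<chi> j. if j = i then - x $ j else x $ j) $ k) ^ s k) = - (\<Prod>k\<in>UNIV. (x $ k) ^ s k)"
    for x :: "real^'c"
    using assms by (subst (1 2) prod.remove[of UNIV i]) (auto intro!: prod.cong)
  have "(\<integral>\<^sup>+x. ennreal (\<Prod>i\<in>UNIV. (x $ i) ^ s i) \<partial>(sphere_measure :: (real ^ 'c) measure)) =
    (\<integral>\<^sup>+x. ennreal (- (\<Prod>i\<in>UNIV. (x $ i) ^ s i)) \<partial>sphere_measure)"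
    unfolding neg[symmetric] by (subst nn_integral_sphere_reflect) auto
  then show ?thesis
    by (simp add: real_lebesgue_integral_def[OF integrable_sphere_monomial])
qed

text \<open>An odd exponent makes both sides 0, so the formula holds for every monomial that occurs
  in a power of \<open>V\<close>.\<close>

lemma integral_sphere_monomial:
  fixes s :: "'c::finite \<Rightarrow> nat"
  defines "S \<equiv> \<Sum>i\<in>UNIV. s i"
  shows "(\<integral>x. (\<Prod>i\<in>UNIV. (x $ i) ^ s i) \<partial>(sphere_measure :: (real ^ 'c) measure)) *
      (2 powr ((real S + real CARD('c)) / 2 - 1) * Gamma ((real S + real CARD('c)) / 2)) =
    (2 * pi) powr (real CARD('c) / 2) * (\<Prod>i\<in>UNIV. std_moment (s i))"
proof (cases "\<forall>i. even (s i)")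
  case True
  have nonneg: "(\<Prod>i\<in>UNIV. (x $ i) ^ s i) \<ge> 0" for x :: "real^'c"
    using True by (intro prod_nonneg) (auto simp: zero_le_even_power)
  have G: "Gamma ((real S + real CARD('c)) / 2) \<ge> 0"
    by (intro less_imp_le Gamma_real_pos) (simp add: add_nonneg_pos)
  have "(\<integral>\<^sup>+x. ennreal (\<Prod>i\<in>UNIV. (x $ i) ^ s i) \<partial>(sphere_measure :: (real ^ 'c) measure)) =
     ennreal (\<integral>x. (\<Prod>i\<in>UNIV. (x $ i) ^ s i) \<partial>sphere_measure)"
    using nonneg by (intro nn_integral_eq_integral integrable_sphere_monomial) auto
  with nn_integral_sphere_monomial[of s] True
  show ?thesis unfolding S_def[symmetric]
    using G nonneg by (simp add: ennreal_mult[symmetric] integral_nonneg_AE prod_nonneg std_moment_nonneg)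
next
  case False
  then obtain i where i: "odd (s i)" by blast
  have "(\<Prod>i\<in>UNIV. std_moment (s i)) = 0"
    using i by (intro prod_zero) (auto simp: std_moment_def)
  then show ?thesis using integral_sphere_monomial_odd[of s i, OF i] by simp
qed

section \<open>Isomorphisms of coloured graphs\<close>

text \<open>The set map written inline in \<open>cgraph_isos_def\<close>. A vertex may contain
  several colours, and each colour part is moved by its own bijection.\<close>

definition vertex_map :: "('h, 'c) cgraph \<Rightarrow> ('c \<Rightarrow> 'h \<Rightarrow> 'k) \<Rightarrow> 'h set \<Rightarrow> 'k set" where
  "vertex_map G j v = (\<Union>i. j i ` (v \<inter> half_edges G i))"

lemma cgraph_isos_iff:
  "j \<in> cgraph_isos G G' \<longleftrightarrow>
     (\<forall>i. j i \<in> extensional (half_edges G i)) \<and>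
     (\<forall>i. bij_betw (j i) (half_edges G i) (half_edges G' i)) \<and>
     (\<forall>i. (\<lambda>e. j i ` e) ` edges G i = edges G' i) \<and>
     vertex_map G j ` verts G = verts G'"
  unfolding cgraph_isos_def vertex_map_def[abs_def] mem_Collect_eq
  by (simp only: all_conj_distrib conj_assoc)

lemma cgraph_iso_apply:
  assumes "j \<in> cgraph_isos G G'" "h \<in> half_edges G i"
  shows "j i h \<in> half_edges G' i"
  using assms bij_betwE unfolding cgraph_isos_iff by metis

lemma wf_cgraphD:
  assumes "wf_cgraph G"
  shows "finite (half_edges G i)"
    and "i \<noteq> i' \<Longrightarrow> half_edges G i \<inter> half_edges G i' = {}"
    and "partition_on (\<Union>i. half_edges G i) (verts G)"
    and "partition_on (half_edges G i) (edges G i)"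
    and "e \<in> edges G i \<Longrightarrow> card e = 2"
    and "e \<in> edges G i \<Longrightarrow> e \<subseteq> half_edges G i"
    and "v \<in> verts G \<Longrightarrow> v \<subseteq> (\<Union>i. half_edges G i)"
    and "v \<in> verts G \<Longrightarrow> v \<noteq> {}"
    and "finite (verts G)"
    and "finite (edges G i)"
proof -
  note wf = assms[unfolded wf_cgraph_def]
  show 1: "finite (half_edges G i)" for i using wf by blast
  show "i \<noteq> i' \<Longrightarrow> half_edges G i \<inter> half_edges G i' = {}"
    using wf by (auto simp: disjoint_family_on_def)
  show 2: "partition_on (\<Union>i. half_edges G i) (verts G)" using wf by blast
  show 3: "partition_on (half_edges G i) (edges G i)" using wf by blast
  show "e \<in> edges G i \<Longrightarrow> card e = 2" using wf by blast
  show "e \<in> edges G i \<Longrightarrow> e \<subseteq> half_edges G i" using partition_onD1[OF 3] by blast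
  show "v \<in> verts G \<Longrightarrow> v \<subseteq> (\<Union>i. half_edges G i)" using partition_onD1[OF 2] by blast
  show "v \<in> verts G \<Longrightarrow> v \<noteq> {}" using partition_onD3[OF 2] by blast
  show "finite (verts G)" by (rule finite_elements[OF _ 2]) (simp add: 1)
  show "finite (edges G i)" by (rule finite_elements[OF _ 3]) (simp add: 1)
qed

lemma finite_cgraph_isos:
  assumes "wf_cgraph G" "wf_cgraph G'"
  shows "finite (cgraph_isos G G')"
proof (rule finite_subset)
  show "cgraph_isos G G' \<subseteq> (\<Pi>\<^sub>E i\<in>UNIV. half_edges G i \<rightarrow>\<^sub>E half_edges G' i)"
  proof
    fix j assume "j \<in> cgraph_isos G G'"
    then have "j i \<in> half_edges G i \<rightarrow>\<^sub>E half_edges G' i" for i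
      using cgraph_iso_apply[of j G G'] by (auto simp: PiE_def cgraph_isos_iff)
    then show "j \<in> (\<Pi>\<^sub>E i\<in>UNIV. half_edges G i \<rightarrow>\<^sub>E half_edges G' i)" by auto
  qed
  show "finite (\<Pi>\<^sub>E i\<in>UNIV. half_edges G i \<rightarrow>\<^sub>E half_edges G' i)"
    using assms by (intro finite_PiE) (auto simp: wf_cgraphD)
qed

text \<open>Colour classes of the target are disjoint, so the part of colour \<open>i\<close> in an
  image vertex can only come from \<open>j i\<close>. Preservation of degrees and injectivity on
  vertices rest on this.\<close>

lemma vertex_map_Int:
  assumes "wf_cgraph G'" "j \<in> cgraph_isos G G'"
  shows "vertex_map G j v \<inter> half_edges G' i = j i ` (v \<inter> half_edges G i)"
proof -
  note j = cgraph_iso_apply[OF assms(2)]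
  show ?thesis
  proof (intro equalityI subsetI)
    fix x assume "x \<in> vertex_map G j v \<inter> half_edges G' i"
    then obtain i' h where h: "h \<in> v" "h \<in> half_edges G i'" "x = j i' h" and x: "x \<in> half_edges G' i"
      by (auto simp: vertex_map_def)
    then have "i' = i"
      using j[of h i'] wf_cgraphD(2)[OF assms(1), of i i'] by blast
    then show "x \<in> j i ` (v \<inter> half_edges G i)" using h by blast
  next
    fix x assume "x \<in> j i ` (v \<inter> half_edges G i)"
    then show "x \<in> vertex_map G j v \<inter> half_edges G' i"
      using j unfolding vertex_map_def by blast
  qed
qed

lemma vdeg_vertex_map:
  assumes "wf_cgraph G'" "j \<in> cgraph_isos G G'"
  shows "vdeg G' (vertex_map G j v) = vdeg G v"
proof
  fix i
  have "inj_on (j i) (v \<inter> half_edges G i)"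
    using assms(2) by (auto simp: cgraph_isos_iff bij_betw_def intro: inj_on_subset)
  then show "vdeg G' (vertex_map G j v) i = vdeg G v i"
    by (simp add: vdeg_def vertex_map_Int[OF assms] card_image)
qed

lemma inj_on_vertex_map:
  assumes "wf_cgraph G" "wf_cgraph G'" "j \<in> cgraph_isos G G'"
  shows "inj_on (vertex_map G j) (verts G)"
proof (rule inj_onI)
  fix v w assume v: "v \<in> verts G" and w: "w \<in> verts G" and eq: "vertex_map G j v = vertex_map G j w"
  have "v \<inter> half_edges G i = w \<inter> half_edges G i" for i
  proof -
    have "inj_on (j i) (half_edges G i)"
      using assms(3) by (auto simp: cgraph_isos_iff bij_betw_def)
    moreover have "j i ` (v \<inter> half_edges G i) = j i ` (w \<inter> half_edges G i)"
      using eq vertex_map_Int[OF assms(2,3)] by metis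
    ultimately show ?thesis by (simp add: inj_on_image_eq_iff)
  qed
  then show "v = w"
    using wf_cgraphD(7)[OF assms(1) v] wf_cgraphD(7)[OF assms(1) w] by blast
qed

lemma prod_vdeg_iso:
  fixes h :: "('c::finite \<Rightarrow> nat) \<Rightarrow> 'b::comm_monoid_mult" and G :: "('h, 'c) cgraph"
  assumes "wf_cgraph G" "wf_cgraph G'" "j \<in> cgraph_isos G G'"
  shows "(\<Prod>v\<in>verts G. h (vdeg G v)) = (\<Prod>v\<in>verts G'. h (vdeg G' v))"
proof -
  have "verts G' = vertex_map G j ` verts G"
    using assms(3) by (simp add: cgraph_isos_iff)
  then show ?thesis
    by (simp add: prod.reindex[OF inj_on_vertex_map[OF assms]] vdeg_vertex_map[OF assms(2,3)])
qed

section \<open>Identity, composition and inverses of isomorphisms\<close>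

lemma cgraph_isos_id:
  assumes "wf_cgraph G"
  shows "(\<lambda>i. restrict id (half_edges G i)) \<in> cgraph_isos G G"
proof -
  have "restrict id (half_edges G i) ` e = e" if "e \<subseteq> half_edges G i" for i e
    using that by force
  moreover have "(\<Union>i. restrict id (half_edges G i) ` (v \<inter> half_edges G i)) = v" if "v \<in> verts G" for v
    using wf_cgraphD(7)[OF assms that] by force
  ultimately show ?thesis
    using wf_cgraphD(6)[OF assms]
    by (auto simp: cgraph_isos_iff vertex_map_def bij_betw_def inj_on_def image_iff)
qed

lemma cgraph_isos_compose:
  fixes G :: "('h, 'c::finite) cgraph"
  assumes wf: "wf_cgraph G" "wf_cgraph G'"
    and j: "j \<in> cgraph_isos G G'" and k: "k \<in> cgraph_isos G' G''"
  shows "(\<lambda>i. compose (half_edges G i) (k i) (j i)) \<in> cgraph_isos G G''"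
proof -
  have "bij_betw (compose (half_edges G i) (k i) (j i)) (half_edges G i) (half_edges G'' i)" for i
    using j k by (auto simp: cgraph_isos_iff intro: bij_betw_compose)
  moreover have im: "compose (half_edges G i) (k i) (j i) ` e = k i ` j i ` e" if "e \<subseteq> half_edges G i" for i e
    using that by (force simp: compose_def)
  moreover have "(\<lambda>e. compose (half_edges G i) (k i) (j i) ` e) ` edges G i = edges G'' i" for i
  proof -
    have "(\<lambda>e. compose (half_edges G i) (k i) (j i) ` e) ` edges G i = (\<lambda>e. k i ` e) ` (\<lambda>e. j i ` e) ` edges G i"
      using im wf_cgraphD(6)[OF wf(1)] by (auto simp: image_image)
    then show ?thesis using j k by (simp add: cgraph_isos_iff)
  qed
  moreover have "vertex_map G (\<lambda>i. compose (half_edges G i) (k i) (j i)) v =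
      vertex_map G' k (vertex_map G j v)" for v
    unfolding vertex_map_def[of G' k] vertex_map_Int[OF wf(2) j] by (simp add: vertex_map_def im)
  then have "vertex_map G (\<lambda>i. compose (half_edges G i) (k i) (j i)) ` verts G = verts G''"
    using j k by (simp add: cgraph_isos_iff image_image[symmetric])
  ultimately show ?thesis
    by (simp add: cgraph_isos_iff compose_extensional)
qed

lemma cgraph_isos_inverse:
  fixes G :: "('h, 'c::finite) cgraph"
  assumes wf: "wf_cgraph G" "wf_cgraph G'" and j: "j \<in> cgraph_isos G G'"
  shows "(\<lambda>i. restrict (inv_into (half_edges G i) (j i)) (half_edges G' i)) \<in> cgraph_isos G' G"
proof -
  define k where "k i = restrict (inv_into (half_edges G i) (j i)) (half_edges G' i)" for i
  have bij: "bij_betw (j i) (half_edges G i) (half_edges G' i)" for i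
    using j by (simp add: cgraph_isos_iff)
  have kj: "k i ` j i ` e = e" if "e \<subseteq> half_edges G i" for i e
  proof -
    have "k i (j i x) = x" if "x \<in> half_edges G i" for x
      using that bij[of i] by (auto simp: k_def bij_betw_def inv_into_f_f)
    then show ?thesis using that by (force simp: image_image)
  qed
  have "bij_betw (k i) (half_edges G' i) (half_edges G i)" for i
    using bij_betw_inv_into[OF bij[of i]] by (simp add: k_def)
  moreover have "(\<lambda>e. k i ` e) ` edges G' i = edges G i" for i
  proof -
    have "(\<lambda>e. k i ` e) ` edges G' i = (\<lambda>e. k i ` j i ` e) ` edges G i"
      using j by (auto simp: cgraph_isos_iff simp flip: image_image)
    also have "\<dots> = edges G i"
      using kj wf_cgraphD(6)[OF wf(1)] by (auto simp: image_iff)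
    finally show ?thesis .
  qed
  moreover have "vertex_map G' k ` verts G' = verts G"
  proof -
    have "vertex_map G' k (vertex_map G j v) = v" if "v \<in> verts G" for v
      unfolding vertex_map_def[of G' k] vertex_map_Int[OF wf(2) j]
      using wf_cgraphD(7)[OF wf(1) that] by (auto simp: kj)
    moreover have "verts G' = vertex_map G j ` verts G"
      using j by (simp add: cgraph_isos_iff)
    ultimately show ?thesis by (auto simp: image_iff)
  qed
  moreover have "k i \<in> extensional (half_edges G' i)" for i
    by (simp add: k_def)
  ultimately have "k \<in> cgraph_isos G' G"
    by (simp add: cgraph_isos_iff)
  then show ?thesis
    by (simp add: k_def[abs_def])
qed

lemma cgraph_isos_sym:
  fixes G :: "('h, 'c::finite) cgraph"
  assumes "wf_cgraph G" "wf_cgraph G'" "cgraph_isos G G' \<noteq> {}"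
  shows "cgraph_isos G' G \<noteq> {}"
  using cgraph_isos_inverse[OF assms(1,2)] assms(3) by blast

lemma cgraph_isos_trans:
  fixes G :: "('h, 'c::finite) cgraph"
  assumes "wf_cgraph G" "wf_cgraph G'" "cgraph_isos G G' \<noteq> {}" "cgraph_isos G' G'' \<noteq> {}"
  shows "cgraph_isos G G'' \<noteq> {}"
  using cgraph_isos_compose[OF assms(1,2)] assms(3,4) by blast

text \<open>The isomorphisms form a torsor under the automorphisms of \<open>G\<close>: composing
  with one fixed isomorphism \<open>k\<close> is a bijection.\<close>

lemma card_cgraph_isos:
  fixes G :: "('h, 'c::finite) cgraph"
  assumes wf: "wf_cgraph G" "wf_cgraph G'" and ne: "cgraph_isos G G' \<noteq> {}"
  shows "card (cgraph_isos G G') = cgraph_aut_card G"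
proof -
  obtain k where k: "k \<in> cgraph_isos G G'" using ne by blast
  have bij: "bij_betw (k i) (half_edges G i) (half_edges G' i)" for i
    using k by (simp add: cgraph_isos_iff)
  let ?F = "\<lambda>a i. compose (half_edges G i) (k i) (a i)"
  have "bij_betw ?F (cgraph_isos G G) (cgraph_isos G G')"
  proof (rule bij_betw_imageI)
    show "inj_on ?F (cgraph_isos G G)"
    proof (intro inj_onI ext)
      fix a b i x
      assume a: "a \<in> cgraph_isos G G" and b: "b \<in> cgraph_isos G G" and eq: "?F a = ?F b"
      show "a i x = b i x"
      proof (cases "x \<in> half_edges G i")
        case True
        have "k i (a i x) = k i (b i x)"
          using fun_cong[OF fun_cong[OF eq, of i], of x] True by (simp add: compose_def)
        moreover have "a i x \<in> half_edges G i" "b i x \<in> half_edges G i"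
          using True by (auto intro: cgraph_iso_apply[OF a] cgraph_iso_apply[OF b])
        ultimately show ?thesis using bij[of i] by (auto simp: bij_betw_def inj_on_def)
      next
        case False
        then show ?thesis using a b by (auto simp: cgraph_isos_iff extensional_def)
      qed
    qed
    show "?F ` cgraph_isos G G = cgraph_isos G G'"
    proof (intro equalityI subsetI)
      fix b assume b: "b \<in> cgraph_isos G G'"
      let ?k' = "\<lambda>i. restrict (inv_into (half_edges G i) (k i)) (half_edges G' i)"
      \<comment> \<open>The preimage of \<open>b\<close> is the inverse of \<open>k\<close> after
        \<open>b\<close>.\<close>
      let ?a = "\<lambda>i. compose (half_edges G i) (?k' i) (b i)"
      have "?a \<in> cgraph_isos G G"
        by (intro cgraph_isos_compose[OF wf b] cgraph_isos_inverse[OF wf k])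
      moreover have "b = ?F ?a"
      proof (intro ext)
        fix i x show "b i x = ?F ?a i x"
        proof (cases "x \<in> half_edges G i")
          case True
          then have "b i x \<in> half_edges G' i" using cgraph_iso_apply[OF b] by blast
          then show ?thesis using True bij_betw_inv_into_right[OF bij[of i]] by (simp add: compose_def)
        next
          case False
          then show ?thesis using b by (auto simp: cgraph_isos_iff extensional_def compose_def)
        qed
      qed
      ultimately show "b \<in> ?F ` cgraph_isos G G"
        using image_eqI[where f = ?F and x = ?a] by blast
    qed (use cgraph_isos_compose[OF wf(1,1) _ k] in auto)
  qed
  then show ?thesis
    unfolding cgraph_aut_card_def by (rule bij_betw_same_card[symmetric])
qed

lemma equiv_cgraph_rel: "equiv {G. wf_cgraph G} cgraph_rel"
proof (rule equivI)
  show "cgraph_rel \<subseteq> {G. wf_cgraph G} \<times> {G. wf_cgraph G}"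
    by (auto simp: cgraph_rel_def)
  show "refl_on {G. wf_cgraph G} cgraph_rel"
    using cgraph_isos_id by (auto simp: refl_on_def cgraph_rel_def)
  show "sym cgraph_rel"
    using cgraph_isos_sym unfolding sym_def cgraph_rel_def by blast
  show "trans cgraph_rel"
    using cgraph_isos_trans unfolding trans_def cgraph_rel_def by blast
qed

text \<open>Standard graphs will carry structured labels, whereas isomorphism classes consist of
  graphs on \<open>nat\<close>; this is the passage between them.\<close>

lemma cgraph_relabel:
  fixes \<iota> :: "'h \<Rightarrow> 'k" and G :: "('h, 'c::finite) cgraph"
  assumes wf: "wf_cgraph G" and inj: "inj \<iota>"
  obtains G' :: "('k, 'c) cgraph" where "wf_cgraph G'" "cgraph_isos G G' \<noteq> {}"
proof
  define G' :: "('k, 'c) cgraph" where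
    "G' = CGraph (\<lambda>i. \<iota> ` half_edges G i) ((`) \<iota> ` verts G) (\<lambda>i. (`) \<iota> ` edges G i)"
  have part: "partition_on (\<iota> ` A) ((`) \<iota> ` P)" if "partition_on A P" for A P
  proof -
    have "(`) \<iota> ` P - {{}} = (`) \<iota> ` P"
      using partition_onD3[OF that] by auto
    then show ?thesis
      using partition_on_inj_image[OF that inj_on_subset[OF inj subset_UNIV]] by simp
  qed
  show "wf_cgraph G'"
    unfolding wf_cgraph_def
  proof (intro conjI allI ballI)
    show "finite (half_edges G' i)" for i
      by (simp add: G'_def wf_cgraphD[OF wf])
    show "disjoint_family (half_edges G')"
      using wf_cgraphD(2)[OF wf] by (auto simp: G'_def disjoint_family_on_def simp flip: image_Int[OF inj])
    show "partition_on (\<Union>i. half_edges G' i) (verts G')"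
      using part[OF wf_cgraphD(3)[OF wf]] by (simp add: G'_def image_UN)
    show "partition_on (half_edges G' i) (edges G' i)" for i
      using part[OF wf_cgraphD(4)[OF wf]] by (simp add: G'_def)
    show "card e = 2" if "e \<in> edges G' i" for i e
      using that wf_cgraphD(5)[OF wf] by (auto simp: G'_def card_image[OF inj_on_subset[OF inj subset_UNIV]])
  qed
  have im: "restrict \<iota> (half_edges G i) ` e = \<iota> ` e" if "e \<subseteq> half_edges G i" for i e
    using that by force
  have vm: "vertex_map G (\<lambda>i. restrict \<iota> (half_edges G i)) v = \<iota> ` v" if "v \<in> verts G" for v
  proof -
    have "v = (\<Union>i. v \<inter> half_edges G i)" using wf_cgraphD(7)[OF wf that] by blast
    then have "\<iota> ` v = (\<Union>i. \<iota> ` (v \<inter> half_edges G i))" by blast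
    then show ?thesis by (simp add: vertex_map_def im)
  qed
  have "(\<lambda>i. restrict \<iota> (half_edges G i)) \<in> cgraph_isos G G'"
    unfolding cgraph_isos_iff
  proof (intro conjI allI)
    show "bij_betw (restrict \<iota> (half_edges G i)) (half_edges G i) (half_edges G' i)" for i
      by (auto simp: G'_def bij_betw_def inj_on_def inj_eq[OF inj])
    show "(\<lambda>e. restrict \<iota> (half_edges G i) ` e) ` edges G i = edges G' i" for i
      using im wf_cgraphD(6)[OF wf] by (auto simp: G'_def image_iff)
    show "vertex_map G (\<lambda>i. restrict \<iota> (half_edges G i)) ` verts G = verts G'"
      using vm by (auto simp: G'_def image_iff)
  qed simp
  then show "cgraph_isos G G' \<noteq> {}" by blast
qed

text \<open>Handshake count: twice the number of edges is the number of half-edges, hence the sum of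
  all degrees, which is \<open>k\<close> per vertex. Doubling avoids a division.\<close>

lemma euler_char_regular:
  fixes G :: "('h, 'c::finite) cgraph"
  assumes wf: "wf_cgraph G" and k: "\<And>v. v \<in> verts G \<Longrightarrow> (\<Sum>i\<in>UNIV. vdeg G v i) = k"
  shows "2 * euler_char G = (2 - int k) * int (card (verts G))"
proof -
  have "card (\<Union>i. edges G i) = (\<Sum>i\<in>UNIV. card (edges G i))"
  proof (rule card_UN_disjoint)
    \<comment> \<open>An edge of two colours would lie in two disjoint label sets and be empty, but
      edges have two elements.\<close>
    show "\<forall>i\<in>UNIV. \<forall>j\<in>UNIV. i \<noteq> j \<longrightarrow> edges G i \<inter> edges G j = {}"
    proof (intro ballI impI equals0I)
      fix i j e assume "i \<noteq> j" and e: "e \<in> edges G i \<inter> edges G j"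
      then have "e = {}" using wf_cgraphD(6)[OF wf, of e] wf_cgraphD(2)[OF wf, of i j] by blast
      then show False using e wf_cgraphD(5)[OF wf, of e i] by simp
    qed
  qed (auto simp: wf_cgraphD(10)[OF wf])
  also have "2 * \<dots> = (\<Sum>i\<in>UNIV. 2 * card (edges G i))" by (rule sum_distrib_left)
  also have "\<dots> = (\<Sum>i\<in>UNIV. card (half_edges G i))"
  proof (rule sum.cong)
    fix i
    have "card (half_edges G i) = card (\<Union>(edges G i))"
      using partition_onD1[OF wf_cgraphD(4)[OF wf]] by metis
    also have "\<dots> = (\<Sum>e\<in>edges G i. card e)"
    proof (rule card_Union_disjoint)
      show "disjoint (edges G i)" by (rule partition_onD2[OF wf_cgraphD(4)[OF wf]])
      show "finite e" if "e \<in> edges G i" for e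
        using wf_cgraphD(6)[OF wf that] wf_cgraphD(1)[OF wf] by (rule finite_subset)
    qed
    also have "\<dots> = 2 * card (edges G i)" using wf_cgraphD(5)[OF wf] by simp
    finally show "2 * card (edges G i) = card (half_edges G i)" ..
  qed simp
  also have "\<dots> = (\<Sum>i\<in>UNIV. \<Sum>v\<in>verts G. vdeg G v i)"
  proof (rule sum.cong)
    fix i
    have "half_edges G i = (\<Union>v\<in>verts G. v \<inter> half_edges G i)"
      using partition_onD1[OF wf_cgraphD(3)[OF wf]] by blast
    then have "card (half_edges G i) = card (\<Union>v\<in>verts G. v \<inter> half_edges G i)" by simp
    also have "\<dots> = (\<Sum>v\<in>verts G. card (v \<inter> half_edges G i))"
      using partition_onD2[OF wf_cgraphD(3)[OF wf]] wf_cgraphD(1)[OF wf]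
      by (intro card_UN_disjoint) (auto simp: wf_cgraphD(9)[OF wf] pairwise_def disjnt_def)
    finally show "card (half_edges G i) = (\<Sum>v\<in>verts G. vdeg G v i)" by (simp add: vdeg_def)
  qed simp
  also have "\<dots> = (\<Sum>v\<in>verts G. \<Sum>i\<in>UNIV. vdeg G v i)" by (rule sum.swap)
  also have "\<dots> = k * card (verts G)" by (simp add: k)
  finally have "2 * int (card (\<Union>i. edges G i)) = int k * int (card (verts G))"
    by (metis of_nat_mult of_nat_numeral)
  then show ?thesis by (simp add: euler_char_def algebra_simps)
qed

section \<open>Labelled presentations\<close>

definition pairings :: "'a set \<Rightarrow> 'a set set set" where
  "pairings X = {E. partition_on X E \<and> (\<forall>e\<in>E. card e = 2)}"

lemma finite_pairings: "finite X \<Longrightarrow> finite (pairings X)"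
  unfolding pairings_def by (rule finite_subset[OF _ finitely_many_partition_on[of X]]) auto

lemma pairings_image:
  assumes "bij_betw f X Y" "E \<in> pairings X"
  shows "(`) f ` E \<in> pairings Y"
proof -
  have inj: "inj_on f X" and Y: "Y = f ` X" and E: "partition_on X E" and c: "\<And>e. e \<in> E \<Longrightarrow> card e = 2"
    using assms by (auto simp: bij_betw_def pairings_def)
  have "(`) f ` E - {{}} = (`) f ` E"
    using partition_onD3[OF E] by auto
  then have "partition_on Y ((`) f ` E)"
    using partition_on_inj_image[OF E inj] Y by simp
  moreover have "card (f ` e) = 2" if "e \<in> E" for e
  proof -
    have "e \<subseteq> X" using partition_onD1[OF E] that by blast
    then show ?thesis using c[OF that] inj_on_subset[OF inj] by (simp add: card_image)
  qed
  ultimately show ?thesis by (auto simp: pairings_def)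
qed

text \<open>The label \<open>(a, i, l)\<close> is half-edge number \<open>l\<close> of colour
  \<open>i\<close> at vertex number \<open>a\<close>. Vertex and colour are read off the label, and
  \<open>f a\<close> is the degree of vertex \<open>a\<close>.\<close>

definition std_vertex :: "(nat \<Rightarrow> 'c \<Rightarrow> nat) \<Rightarrow> nat \<Rightarrow> (nat \<times> 'c \<times> nat) set" where
  "std_vertex f a = {(a, i, l) | i l. l < f a i}"

definition std_half :: "nat \<Rightarrow> (nat \<Rightarrow> 'c \<Rightarrow> nat) \<Rightarrow> 'c \<Rightarrow> (nat \<times> 'c \<times> nat) set" where
  "std_half N f i = {(a, i, l) | a l. a < N \<and> l < f a i}"

definition std_graph ::
  "nat \<Rightarrow> (nat \<Rightarrow> 'c \<Rightarrow> nat) \<Rightarrow> ('c \<Rightarrow> (nat \<times> 'c \<times> nat) set set) \<Rightarrow> (nat \<times> 'c \<times> nat, 'c) cgraph" where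
  "std_graph N f E = CGraph (std_half N f) (std_vertex f ` {..<N}) E"

text \<open>\<open>f\<close> chooses a monomial for each vertex and \<open>E\<close> pairs the
  half-edges. Extensionality of \<open>f\<close> keeps values beyond \<open>N\<close> from
  multiplying the count.\<close>

definition std_graphs ::
  "nat \<Rightarrow> ('c \<Rightarrow> nat) set \<Rightarrow> ((nat \<Rightarrow> 'c \<Rightarrow> nat) \<times> ('c \<Rightarrow> (nat \<times> 'c \<times> nat) set set)) set" where
  "std_graphs N W = (SIGMA f : {..<N} \<rightarrow>\<^sub>E W. \<Pi>\<^sub>E i\<in>UNIV. pairings (std_half N f i))"

lemma std_graph_sel [simp]:
  "half_edges (std_graph N f E) = std_half N f"
  "verts (std_graph N f E) = std_vertex f ` {..<N}"
  "edges (std_graph N f E) = E"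
  by (simp_all add: std_graph_def)

lemma std_half_eq: "std_half N f i = (\<lambda>(a, l). (a, i, l)) ` (SIGMA a : {..<N}. {..<f a i})"
  by (auto simp: std_half_def)

lemma finite_std_half: "finite (std_half N f i)"
  by (simp add: std_half_eq)

lemma card_std_half: "card (std_half N f i) = (\<Sum>a<N. f a i)"
  unfolding std_half_eq by (subst card_image) (auto simp: inj_on_def)

lemma std_vertex_Int: "a < N \<Longrightarrow> std_vertex f a \<inter> std_half N f i = (\<lambda>l. (a, i, l)) ` {..<f a i}"
  by (auto simp: std_vertex_def std_half_def)

lemma vdeg_std_vertex: "a < N \<Longrightarrow> vdeg (std_graph N f E) (std_vertex f a) = f a"
  by (rule ext) (simp add: vdeg_def std_vertex_Int card_image inj_on_def)

lemma finite_std_graphs: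
  assumes "finite W"
  shows "finite (std_graphs N W :: ((nat \<Rightarrow> 'c::finite \<Rightarrow> nat) \<times> _) set)"
  unfolding std_graphs_def using assms
  by (intro finite_SigmaI finite_PiE) (auto simp: finite_pairings finite_std_half)

lemma std_vertex_nonempty: "\<exists>i. 0 < f a i \<Longrightarrow> std_vertex f a \<noteq> {}"
  by (auto simp: std_vertex_def)

text \<open>A vertex of positive degree contains a label that names it; vertices of degree zero
  would all be the same empty set.\<close>

lemma inj_on_std_vertex:
  assumes "\<And>a. a < N \<Longrightarrow> \<exists>i. 0 < f a i"
  shows "inj_on (std_vertex f) {..<N}"
proof (rule inj_onI)
  fix a b assume a: "a \<in> {..<N}" and eq: "std_vertex f a = std_vertex f b"
  obtain i where "0 < f a i" using assms a by auto
  then have "(a, i, 0) \<in> std_vertex f b" unfolding eq[symmetric] by (simp add: std_vertex_def)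
  then show "a = b" using eq by (auto simp: std_vertex_def)
qed

lemma wf_std_graph:
  fixes f :: "nat \<Rightarrow> 'c::finite \<Rightarrow> nat"
  assumes "\<And>a. a < N \<Longrightarrow> \<exists>i. 0 < f a i" and "\<And>i. E i \<in> pairings (std_half N f i)"
  shows "wf_cgraph (std_graph N f E)"
  unfolding wf_cgraph_def
proof (intro conjI allI)
  show "disjoint_family (half_edges (std_graph N f E))"
    by (auto simp: disjoint_family_on_def std_half_def)
  show "partition_on (\<Union>i. half_edges (std_graph N f E) i) (verts (std_graph N f E))"
  proof (rule partition_onI)
    show "\<Union>(verts (std_graph N f E)) = (\<Union>i. half_edges (std_graph N f E) i)"
      by (auto simp: std_half_def std_vertex_def)
    show "{} \<notin> verts (std_graph N f E)"
    proof
      assume "{} \<in> verts (std_graph N f E)"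
      then obtain a where "a < N" "std_vertex f a = {}" by auto
      then show False using std_vertex_nonempty[of f a] assms(1)[of a] by simp
    qed
  qed (auto simp: std_vertex_def disjnt_def)
qed (use assms(2) in \<open>auto simp: finite_std_half pairings_def\<close>)

lemma std_graphsD:
  assumes "(f, E) \<in> std_graphs N W"
  shows "f \<in> {..<N} \<rightarrow>\<^sub>E W" "a < N \<Longrightarrow> f a \<in> W" "E i \<in> pairings (std_half N f i)"
  using assms by (auto simp: std_graphs_def PiE_iff)

lemma wf_std_graphs:
  fixes f :: "nat \<Rightarrow> 'c::finite \<Rightarrow> nat"
  assumes "(f, E) \<in> std_graphs N W" "\<And>w. w \<in> W \<Longrightarrow> \<exists>i. 0 < w i"
  shows "wf_cgraph (std_graph N f E)"
  using std_graphsD[OF assms(1)] assms(2) by (intro wf_std_graph) auto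

section \<open>Labellings of a graph as isomorphisms onto standard graphs\<close>

definition labellings :: "nat \<Rightarrow> ('h, 'c::finite) cgraph \<Rightarrow> (('h set \<Rightarrow> nat) \<times> ('h set \<times> 'c \<Rightarrow> 'h \<Rightarrow> nat)) set" where
  "labellings N G =
     {\<beta> \<in> verts G \<rightarrow>\<^sub>E {..<N}. bij_betw \<beta> (verts G) {..<N}} \<times>
     (\<Pi>\<^sub>E (v, i)\<in>verts G \<times> UNIV.
        {g \<in> v \<inter> half_edges G i \<rightarrow>\<^sub>E {..<vdeg G v i}. bij_betw g (v \<inter> half_edges G i) {..<vdeg G v i}})"

text \<open>The target graph is not an argument, since the labelling already determines it.\<close>

definition labelling_map ::
  "('h, 'c) cgraph \<Rightarrow> ('h set \<Rightarrow> nat) \<times> ('h set \<times> 'c \<Rightarrow> 'h \<Rightarrow> nat) \<Rightarrow> 'c \<Rightarrow> 'h \<Rightarrow> nat \<times> 'c \<times> nat" where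
  "labelling_map G = (\<lambda>(\<beta>, g) i. \<lambda>h\<in>half_edges G i.
     let v = (THE v. v \<in> verts G \<and> h \<in> v) in (\<beta> v, i, g (v, i) h))"

lemma card_bijections:
  assumes "finite A" "finite B" "card A = card B"
  shows "card {f \<in> A \<rightarrow>\<^sub>E B. bij_betw f A B} = fact (card A)"
proof -
  have "bij_betw f A B \<longleftrightarrow> inj_on f A" if "f \<in> A \<rightarrow>\<^sub>E B" for f
    using that assms card_image[of f A] card_subset_eq[OF assms(2), of "f ` A"]
    by (auto simp: bij_betw_def)
  then have "{f \<in> A \<rightarrow>\<^sub>E B. bij_betw f A B} = {f \<in> A \<rightarrow>\<^sub>E B. inj_on f A}" by blast
  then show ?thesis
    using card_inj_on_subset_funcset[OF assms(1,2) subset_refl] assms(3) by (simp add: fact_prod_rev)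
qed

lemma card_labellings:
  fixes G :: "('h, 'c::finite) cgraph"
  assumes wf: "wf_cgraph G" and N: "card (verts G) = N"
  shows "card (labellings N G) = fact N * (\<Prod>v\<in>verts G. \<Prod>i\<in>UNIV. fact (vdeg G v i))"
proof -
  have "card {\<beta> \<in> verts G \<rightarrow>\<^sub>E {..<N}. bij_betw \<beta> (verts G) {..<N}} = fact N"
    using card_bijections[of "verts G" "{..<N}"] wf_cgraphD(9)[OF wf] N by simp
  moreover have "card {g \<in> v \<inter> half_edges G i \<rightarrow>\<^sub>E {..<vdeg G v i}.
      bij_betw g (v \<inter> half_edges G i) {..<vdeg G v i}} = fact (vdeg G v i)" for v i
    unfolding vdeg_def by (rule card_bijections) (auto simp: wf_cgraphD(1)[OF wf])
  then have "card (\<Pi>\<^sub>E (v, i)\<in>verts G \<times> UNIV. {g \<in> v \<inter> half_edges G i \<rightarrow>\<^sub>E {..<vdeg G v i}.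
      bij_betw g (v \<inter> half_edges G i) {..<vdeg G v i}}) = (\<Prod>(v, i)\<in>verts G \<times> UNIV. fact (vdeg G v i))"
    by (subst card_PiE) (auto intro!: prod.cong simp: wf_cgraphD(9)[OF wf])
  ultimately show ?thesis
    by (simp add: labellings_def card_cartesian_product prod.cartesian_product)
qed

lemma the_vertex:
  assumes wf: "wf_cgraph G" and "v \<in> verts G" "h \<in> v"
  shows "(THE v. v \<in> verts G \<and> h \<in> v) = v"
  using assms partition_onD2[OF wf_cgraphD(3)[OF wf]]
  by (intro the_equality) (auto simp: pairwise_def disjnt_def)

lemma labelling_map_apply:
  assumes "wf_cgraph G" "v \<in> verts G" "h \<in> v \<inter> half_edges G i"
  shows "labelling_map G (\<beta>, g) i h = (\<beta> v, i, g (v, i) h)"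
  using assms the_vertex[of G v h] by (simp add: labelling_map_def)

lemma labellingsD:
  assumes "(\<beta>, g) \<in> labellings N G"
  shows "bij_betw \<beta> (verts G) {..<N}" "\<beta> \<in> extensional (verts G)" "g \<in> extensional (verts G \<times> UNIV)"
    and "v \<in> verts G \<Longrightarrow> bij_betw (g (v, i)) (v \<inter> half_edges G i) {..<vdeg G v i}"
    and "v \<in> verts G \<Longrightarrow> g (v, i) \<in> extensional (v \<inter> half_edges G i)"
  using assms by (auto simp: labellings_def PiE_iff)

text \<open>Vertices are nonempty blocks, so the first components of the map reveal all of
  \<open>\<beta>\<close>, and the third components reveal \<open>g\<close>.\<close>

lemma inj_on_labelling_map:
  fixes G :: "('h, 'c::finite) cgraph"
  assumes wf: "wf_cgraph G"
  shows "inj_on (labelling_map G) (labellings N G)"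
proof (rule inj_onI, clarify)
  fix \<beta> g \<beta>' g'
  assume 1: "(\<beta>, g) \<in> labellings N G" and 2: "(\<beta>', g') \<in> labellings N G"
    and eq: "labelling_map G (\<beta>, g) = labelling_map G (\<beta>', g')"
  have *: "\<beta> v = \<beta>' v \<and> g (v, i) h = g' (v, i) h" if "v \<in> verts G" "h \<in> v \<inter> half_edges G i" for v i h
    using fun_cong[OF fun_cong[OF eq, of i], of h] labelling_map_apply[OF wf that] by simp
  show "\<beta> = \<beta>' \<and> g = g'"
  proof
    show "\<beta> = \<beta>'"
    proof (rule extensionalityI[OF labellingsD(2)[OF 1] labellingsD(2)[OF 2]])
      fix v assume v: "v \<in> verts G"
      then obtain h i where "h \<in> v \<inter> half_edges G i"
        using wf_cgraphD(7,8)[OF wf v] by blast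
      then show "\<beta> v = \<beta>' v" using * v by blast
    qed
    show "g = g'"
    proof (rule extensionalityI[OF labellingsD(3)[OF 1] labellingsD(3)[OF 2]])
      fix x :: "'h set \<times> 'c" assume "x \<in> verts G \<times> UNIV"
      then obtain v i where x: "x = (v, i)" "v \<in> verts G" by blast
      have "g (v, i) = g' (v, i)"
        using * x(2) by (intro extensionalityI[OF labellingsD(5)[OF 1] labellingsD(5)[OF 2]]) auto
      then show "g x = g' x" by (simp add: x)
    qed
  qed
qed

lemma labelling_map_iso:
  fixes G :: "('h, 'c::finite) cgraph"
  assumes wf: "wf_cgraph G" and W: "\<And>v. v \<in> verts G \<Longrightarrow> vdeg G v \<in> W"
    and lab: "(\<beta>, g) \<in> labellings N G"
  shows "\<exists>f E. (f, E) \<in> std_graphs N W \<and> labelling_map G (\<beta>, g) \<in> cgraph_isos G (std_graph N f E)"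
proof -
  define j where "j = labelling_map G (\<beta>, g)"
  \<comment> \<open>The target is forced: \<open>f\<close> reads the degrees through the inverse of
    \<open>\<beta>\<close>, and \<open>E\<close> is the image of the edges.\<close>
  define f where "f = (\<lambda>a\<in>{..<N}. vdeg G (inv_into (verts G) \<beta> a))"
  define E where "E i = (`) (j i) ` edges G i" for i
  note \<beta> = labellingsD(1)[OF lab]
  have f: "f (\<beta> v) = vdeg G v" "\<beta> v < N" if "v \<in> verts G" for v
    using \<beta> that bij_betw_apply[OF \<beta> that] by (auto simp: f_def bij_betw_def)
  have ext: "j i \<in> extensional (half_edges G i)" for i
    by (simp add: j_def labelling_map_def)
  have app: "j i h = (\<beta> v, i, g (v, i) h)" if "v \<in> verts G" "h \<in> v \<inter> half_edges G i" for v i h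
    unfolding j_def using labelling_map_apply[OF wf that] .
  have im: "j i ` (v \<inter> half_edges G i) = (\<lambda>l. (\<beta> v, i, l)) ` {..<vdeg G v i}" if v: "v \<in> verts G" for v i
  proof -
    have "j i ` (v \<inter> half_edges G i) = (\<lambda>l. (\<beta> v, i, l)) ` g (v, i) ` (v \<inter> half_edges G i)"
      using app[OF v] by (auto simp: image_image)
    then show ?thesis using labellingsD(4)[OF lab v, of i] by (simp add: bij_betw_def)
  qed
  have cover: "\<exists>v. v \<in> verts G \<and> h \<in> v \<inter> half_edges G i" if "h \<in> half_edges G i" for h i
    using that partition_onD1[OF wf_cgraphD(3)[OF wf]] by blast
  have bij: "bij_betw (j i) (half_edges G i) (std_half N f i)" for i
  proof (rule bij_betw_imageI)
    show "inj_on (j i) (half_edges G i)"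
    proof (rule inj_onI)
      fix h h' assume h: "h \<in> half_edges G i" and h': "h' \<in> half_edges G i" and eq: "j i h = j i h'"
      obtain v v' where v: "v \<in> verts G" "h \<in> v \<inter> half_edges G i"
        and v': "v' \<in> verts G" "h' \<in> v' \<inter> half_edges G i"
        using cover[OF h] cover[OF h'] by blast
      have "\<beta> v = \<beta> v'" using eq app[OF v] app[OF v'] by simp
      then have [simp]: "v' = v" using \<beta> v(1) v'(1) by (auto simp: bij_betw_def inj_on_def)
      have "g (v, i) h = g (v, i) h'" using eq app[OF v] app[OF v'] by simp
      then show "h = h'"
        using labellingsD(4)[OF lab v(1), of i] v(2) v'(2) by (auto simp: bij_betw_def inj_on_def)
    qed
    have "half_edges G i = (\<Union>v\<in>verts G. v \<inter> half_edges G i)"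
      using cover by blast
    then have "j i ` half_edges G i = (\<Union>v\<in>verts G. j i ` (v \<inter> half_edges G i))" by blast
    also have "\<dots> = (\<Union>v\<in>verts G. (\<lambda>l. (\<beta> v, i, l)) ` {..<f (\<beta> v) i})"
      using im f by simp
    also have "\<dots> = (\<Union>a\<in>\<beta> ` verts G. (\<lambda>l. (a, i, l)) ` {..<f a i})" by blast
    also have "\<beta> ` verts G = {..<N}" using \<beta> by (simp add: bij_betw_def)
    also have "(\<Union>a\<in>{..<N}. (\<lambda>l. (a, i, l)) ` {..<f a i}) = std_half N f i"
      by (auto simp: std_half_def)
    finally show "j i ` half_edges G i = std_half N f i" .
  qed
  have "vertex_map G j v = std_vertex f (\<beta> v)" if "v \<in> verts G" for v
    unfolding vertex_map_def im[OF that] f(1)[OF that, symmetric] by (auto simp: std_vertex_def)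
  then have "vertex_map G j ` verts G = std_vertex f ` \<beta> ` verts G"
    by (simp add: image_image)
  also have "\<beta> ` verts G = {..<N}" using \<beta> by (simp add: bij_betw_def)
  finally have "j \<in> cgraph_isos G (std_graph N f E)"
    using ext bij by (simp add: cgraph_isos_iff E_def)
  moreover have "(f, E) \<in> std_graphs N W"
  proof -
    have "edges G i \<in> pairings (half_edges G i)" for i
      using wf_cgraphD(4,5)[OF wf] by (auto simp: pairings_def)
    then have "E i \<in> pairings (std_half N f i)" for i
      unfolding E_def by (rule pairings_image[OF bij])
    moreover have "inv_into (verts G) \<beta> a \<in> verts G" if "a < N" for a
      using \<beta> that inv_into_into[of a \<beta> "verts G"] by (auto simp: bij_betw_def)
    then have "f \<in> {..<N} \<rightarrow>\<^sub>E W" using W by (auto simp: f_def)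
    ultimately show ?thesis by (auto simp: std_graphs_def)
  qed
  ultimately show ?thesis unfolding j_def by blast
qed

text \<open>The vertex numbers are recovered from the action of \<open>j\<close> on vertices, the
  half-edge numbers from the third components of its values.\<close>

lemma iso_imp_labelling_map:
  fixes G :: "('h, 'c::finite) cgraph"
  assumes wf: "wf_cgraph G" and N: "card (verts G) = N" and W: "\<And>w. w \<in> W \<Longrightarrow> \<exists>i. 0 < w i"
    and fE: "(f, E) \<in> std_graphs N W" and j: "j \<in> cgraph_isos G (std_graph N f E)"
  shows "j \<in> labelling_map G ` labellings N G"
proof -
  let ?S = "std_graph N f E"
  have wfS: "wf_cgraph ?S" by (rule wf_std_graphs[OF fE W])
  have nonempty: "\<exists>i. 0 < f a i" if "a < N" for a
    using W[OF std_graphsD(2)[OF fE that]] .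
  have "\<exists>a<N. vertex_map G j v = std_vertex f a" if "v \<in> verts G" for v
  proof -
    have "vertex_map G j v \<in> std_vertex f ` {..<N}"
      using that j imageI[of v "verts G" "vertex_map G j"] by (simp add: cgraph_isos_iff)
    then show ?thesis by auto
  qed
  then obtain b where b: "b v < N" "vertex_map G j v = std_vertex f (b v)" if "v \<in> verts G" for v
    by metis
  define \<beta> where "\<beta> = restrict b (verts G)"
  define g where "g = (\<lambda>(v, i)\<in>verts G \<times> UNIV. \<lambda>h\<in>v \<inter> half_edges G i. snd (snd (j i h)))"
  have "b ` verts G = {..<N}"
  proof (intro equalityI subsetI)
    fix a assume a: "a \<in> {..<N}"
    then have "std_vertex f a \<in> vertex_map G j ` verts G" using j by (auto simp: cgraph_isos_iff)
    then obtain v where v: "v \<in> verts G" "std_vertex f a = std_vertex f (b v)" using b(2) by auto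
    have "a = b v"
      using inj_onD[OF inj_on_std_vertex[OF nonempty] v(2)] a b(1)[OF v(1)] by simp
    then show "a \<in> b ` verts G" using v(1) by blast
  qed (use b in auto)
  \<comment> \<open>A surjection between finite sets of equal size \<open>N\<close> is
    bijective.\<close>
  then have bb: "bij_betw b (verts G) {..<N}"
    using N wf_cgraphD(9)[OF wf] eq_card_imp_inj_on[of "verts G" b] by (auto simp: bij_betw_def)
  have im: "j i ` (v \<inter> half_edges G i) = (\<lambda>l. (b v, i, l)) ` {..<f (b v) i}" if v: "v \<in> verts G" for v i
    using vertex_map_Int[OF wfS j, of v i] b[OF v] std_vertex_Int[of "b v" N f i] by simp
  have deg: "vdeg G v = f (b v)" if v: "v \<in> verts G" for v
    using vdeg_vertex_map[OF wfS j, of v] b[OF v] vdeg_std_vertex[of "b v" N f E] by simp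
  have app: "j i h = (b v, i, snd (snd (j i h)))" if v: "v \<in> verts G" and h: "h \<in> v \<inter> half_edges G i" for v i h
  proof -
    have "j i h \<in> (\<lambda>l. (b v, i, l)) ` {..<f (b v) i}" using im[OF v] h by blast
    then show ?thesis by auto
  qed
  have "bij_betw (\<lambda>h. snd (snd (j i h))) (v \<inter> half_edges G i) {..<vdeg G v i}" if v: "v \<in> verts G" for v i
  proof (rule bij_betw_imageI)
    have "inj_on (j i) (half_edges G i)" using j by (auto simp: cgraph_isos_iff bij_betw_def)
    then show "inj_on (\<lambda>h. snd (snd (j i h))) (v \<inter> half_edges G i)"
      using app[OF v] by (intro inj_onI) (metis IntD2 inj_onD)
    have "(\<lambda>h. snd (snd (j i h))) ` (v \<inter> half_edges G i) = (snd \<circ> snd) ` j i ` (v \<inter> half_edges G i)"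
      by (simp add: image_image)
    also have "\<dots> = {..<vdeg G v i}" by (simp add: im[OF v] deg[OF v] image_image)
    finally show "(\<lambda>h. snd (snd (j i h))) ` (v \<inter> half_edges G i) = {..<vdeg G v i}" .
  qed
  then have g: "bij_betw (g (v, i)) (v \<inter> half_edges G i) {..<vdeg G v i}" if "v \<in> verts G" for v i
    using that by (subst bij_betw_cong[where g = "\<lambda>h. snd (snd (j i h))"]) (auto simp: g_def)
  have bij\<beta>: "bij_betw \<beta> (verts G) {..<N}"
    using bb by (simp add: \<beta>_def cong: bij_betw_cong)
  have "(\<beta>, g) \<in> labellings N G"
    unfolding labellings_def
  proof (rule SigmaI)
    have "\<beta> \<in> verts G \<rightarrow>\<^sub>E {..<N}"
      using bij_betw_apply[OF bij\<beta>] by (auto simp: \<beta>_def)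
    then show "\<beta> \<in> {\<beta> \<in> verts G \<rightarrow>\<^sub>E {..<N}. bij_betw \<beta> (verts G) {..<N}}"
      using bij\<beta> by simp
  next
    show "g \<in> (\<Pi>\<^sub>E (v, i)\<in>verts G \<times> UNIV. {g \<in> v \<inter> half_edges G i \<rightarrow>\<^sub>E {..<vdeg G v i}.
        bij_betw g (v \<inter> half_edges G i) {..<vdeg G v i}})"
    proof (rule PiE_I)
      fix x :: "'h set \<times> 'c" assume "x \<in> verts G \<times> UNIV"
      then obtain v i where x: "x = (v, i)" and v: "v \<in> verts G" by blast
      have "g (v, i) \<in> v \<inter> half_edges G i \<rightarrow>\<^sub>E {..<vdeg G v i}"
        using bij_betw_apply[OF g[OF v]] v by (auto simp: g_def PiE_def)
      then show "g x \<in> (case x of (v, i) \<Rightarrow> {g \<in> v \<inter> half_edges G i \<rightarrow>\<^sub>E {..<vdeg G v i}.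
          bij_betw g (v \<inter> half_edges G i) {..<vdeg G v i}})"
        using g[OF v, of i] by (simp add: x)
    qed (auto simp: g_def)
  qed
  moreover have "j = labelling_map G (\<beta>, g)"
  proof (intro ext)
    fix i h
    show "j i h = labelling_map G (\<beta>, g) i h"
    proof (cases "h \<in> half_edges G i")
      case True
      then obtain v where v: "v \<in> verts G" "h \<in> v \<inter> half_edges G i"
        using partition_onD1[OF wf_cgraphD(3)[OF wf]] by blast
      have "g (v, i) h = snd (snd (j i h))" "\<beta> v = b v"
        using v by (auto simp: g_def \<beta>_def)
      then show ?thesis
        using app[OF v] by (simp only: labelling_map_apply[OF wf v])
    next
      case False
      then show ?thesis
        using j by (auto simp: cgraph_isos_iff extensional_def labelling_map_def)
    qed
  qed
  ultimately show ?thesis by blast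
qed

text \<open>The image of \<open>j\<close> is the set of half-edges of the target, which gives back
  \<open>f\<close>; the image of the edges of \<open>G\<close> is \<open>E\<close>.\<close>

lemma std_graph_determined:
  fixes G :: "('h, 'c::finite) cgraph"
  assumes "(f, E) \<in> std_graphs N W" "j \<in> cgraph_isos G (std_graph N f E)"
    and "(f', E') \<in> std_graphs N W" "j \<in> cgraph_isos G (std_graph N f' E')"
  shows "f = f' \<and> E = E'"
proof
  have half: "std_half N f i = std_half N f' i" for i
    using assms(2,4) by (auto simp: cgraph_isos_iff bij_betw_def)
  have "f a i = f' a i" if "a < N" for a i
  proof -
    have "l < f a i \<longleftrightarrow> l < f' a i" for l
    proof -
      have "(a, i, l) \<in> std_half N f i \<longleftrightarrow> (a, i, l) \<in> std_half N f' i" by (simp add: half)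
      then show ?thesis using that by (simp add: std_half_def)
    qed
    then show ?thesis by (metis linorder_neqE_nat less_irrefl)
  qed
  then show "f = f'"
    using std_graphsD(1)[OF assms(1)] std_graphsD(1)[OF assms(3)] by (intro PiE_ext) (auto simp: fun_eq_iff)
  show "E = E'"
    using assms(2,4) by (auto simp: cgraph_isos_iff fun_eq_iff)
qed

text \<open>The sum counts pairs (standard graph, isomorphism). Projection to the isomorphism is
  injective because the target is determined, and its range is the set of labelling maps.\<close>

lemma sum_card_isos_std_graphs:
  fixes G :: "('h, 'c::finite) cgraph"
  assumes wf: "wf_cgraph G" and N: "card (verts G) = N"
    and W: "finite W" "\<And>w. w \<in> W \<Longrightarrow> \<exists>i. 0 < w i" "\<And>v. v \<in> verts G \<Longrightarrow> vdeg G v \<in> W"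
  shows "(\<Sum>(f, E)\<in>std_graphs N W. card (cgraph_isos G (std_graph N f E))) =
    fact N * (\<Prod>v\<in>verts G. \<Prod>i\<in>UNIV. fact (vdeg G v i))"
proof -
  define S where "S = (SIGMA y : std_graphs N W. cgraph_isos G (std_graph N (fst y) (snd y)))"
  have "(\<Sum>(f, E)\<in>std_graphs N W. card (cgraph_isos G (std_graph N f E))) = card S"
    unfolding S_def using finite_std_graphs[OF W(1)] finite_cgraph_isos[OF wf wf_std_graphs[OF _ W(2)]]
    by (subst card_SigmaI) (auto simp: case_prod_unfold)
  also have "\<dots> = card (snd ` S)"
    by (rule card_image[symmetric], rule inj_onI)
       (auto simp: S_def dest: std_graph_determined)
  also have "snd ` S = labelling_map G ` labellings N G"
  proof (intro equalityI subsetI)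
    fix j assume "j \<in> snd ` S"
    then obtain f E where "(f, E) \<in> std_graphs N W" "j \<in> cgraph_isos G (std_graph N f E)"
      by (auto simp: S_def)
    then show "j \<in> labelling_map G ` labellings N G"
      using iso_imp_labelling_map[OF wf N W(2)] by blast
  next
    fix j assume "j \<in> labelling_map G ` labellings N G"
    then obtain \<beta> g where "j = labelling_map G (\<beta>, g)" "(\<beta>, g) \<in> labellings N G" by auto
    with labelling_map_iso[OF wf W(3)] show "j \<in> snd ` S"
      by (force simp: S_def)
  qed
  also have "card \<dots> = card (labellings N G)"
    by (rule card_image[OF inj_on_labelling_map[OF wf]])
  finally show ?thesis by (simp add: card_labellings[OF wf N])
qed

section \<open>Pairings and Gaussian moments\<close>

text \<open>This is the recursion of pairing numbers: a fixed element among m + 2 has m + 1 possible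
  partners.\<close>

lemma std_moment_Suc_Suc: "std_moment (Suc (Suc m)) = (real m + 1) * std_moment m"
proof (cases "even m")
  case True
  then obtain k where k: "m = 2 * k" by blast
  have "fact (Suc (Suc m)) = (2 * (real k + 1)) * (real m + 1) * (fact m :: real)"
    by (simp add: k algebra_simps)
  moreover have "fact (Suc k) = (real k + 1) * (fact k :: real)" by (simp add: algebra_simps)
  moreover have "Suc (Suc m) div 2 = Suc k" "m div 2 = k" by (simp_all add: k)
  moreover have "real k + 1 \<noteq> 0" by linarith
  ultimately show ?thesis
    using True by (simp only: std_moment_def even_Suc not_not if_True) (simp add: divide_simps)
qed (simp add: std_moment_def)

text \<open>Pairings are sorted by the partner \<open>y\<close> of \<open>x\<close>.\<close>

lemma card_pairings_remove:
  assumes "finite X" "x \<in> X"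
  shows "card (pairings X) = (\<Sum>y\<in>X - {x}. card (pairings (X - {x, y})))"
proof -
  have "pairings X = (\<Union>y\<in>X - {x}. insert {x, y} ` pairings (X - {x, y}))"
  proof (intro equalityI subsetI)
    fix E assume "E \<in> pairings X"
    then have E: "partition_on X E" and c: "\<And>e. e \<in> E \<Longrightarrow> card e = 2"
      by (auto simp: pairings_def)
    obtain e where e: "e \<in> E" "x \<in> e"
      using assms(2) partition_onD1[OF E] by blast
    obtain y where y: "e = {x, y}" "y \<noteq> x"
      using c[OF e(1)] e(2) by (metis card_2_iff doubleton_eq_iff insertE singletonD)
    have ins: "insert e (E - {e}) = E" using e(1) by blast
    have "disjnt e (\<Union>(E - {e}))"
      using partition_onD2[OF E] e(1) by (auto simp: pairwise_def disjnt_def)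
    then have "partition_on (X - e) (E - {e})" "e \<subseteq> X"
      using partition_on_insert[of e "E - {e}" X] E unfolding ins by auto
    then have "E - {e} \<in> pairings (X - {x, y})" "y \<in> X - {x}"
      using c y by (auto simp: pairings_def)
    then show "E \<in> (\<Union>y\<in>X - {x}. insert {x, y} ` pairings (X - {x, y}))"
      using ins y(1) by blast
  next
    fix E assume "E \<in> (\<Union>y\<in>X - {x}. insert {x, y} ` pairings (X - {x, y}))"
    then obtain y F where y: "y \<in> X" "y \<noteq> x" and F: "F \<in> pairings (X - {x, y})" and E: "E = insert {x, y} F"
      by blast
    have "disjnt {x, y} (\<Union>F)"
      using F partition_onD1[of "X - {x, y}" F] by (auto simp: pairings_def disjnt_def)
    then have "partition_on X E"
      using partition_on_insert[of "{x, y}" F X] F y assms(2) by (auto simp: E pairings_def)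
    then show "E \<in> pairings X"
      using F y by (auto simp: pairings_def E card_insert_if)
  qed
  moreover have "card (\<Union>y\<in>X - {x}. insert {x, y} ` pairings (X - {x, y})) =
      (\<Sum>y\<in>X - {x}. card (insert {x, y} ` pairings (X - {x, y})))"
  proof (rule card_UN_disjoint)
    show "\<forall>y\<in>X - {x}. \<forall>z\<in>X - {x}. y \<noteq> z \<longrightarrow>
      insert {x, y} ` pairings (X - {x, y}) \<inter> insert {x, z} ` pairings (X - {x, z}) = {}"
    proof (intro ballI impI equals0I)
      fix y z E
      assume yz: "y \<in> X - {x}" "z \<in> X - {x}" "y \<noteq> z"
        and "E \<in> insert {x, y} ` pairings (X - {x, y}) \<inter> insert {x, z} ` pairings (X - {x, z})"
      then obtain F where E: "{x, y} \<in> E" "E = insert {x, z} F" and F: "F \<in> pairings (X - {x, z})"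
        by blast
      \<comment> \<open>Being different from {x, z}, the block {x, y} has to come from
        \<open>F\<close>, which does not cover \<open>x\<close>.\<close>
      then have "{x, y} \<in> F" using yz by (auto simp: doubleton_eq_iff)
      then have "x \<in> X - {x, z}" using F partition_onD1[of "X - {x, z}" F] by (auto simp: pairings_def)
      then show False by simp
    qed
    show "\<forall>y\<in>X - {x}. finite (insert {x, y} ` pairings (X - {x, y}))"
      by (simp add: assms(1) finite_pairings)
  qed (simp add: assms(1))
  moreover have "card (insert {x, y} ` pairings (X - {x, y})) = card (pairings (X - {x, y}))" for y
  proof (intro card_image inj_onI)
    fix E F assume E: "E \<in> pairings (X - {x, y})" and F: "F \<in> pairings (X - {x, y})"
      and eq: "insert {x, y} E = insert {x, y} F"
    have "{x, y} \<notin> E" "{x, y} \<notin> F"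
      using E F partition_onD1[of "X - {x, y}"] by (auto simp: pairings_def)
    then show "E = F" using eq by (simp add: insert_ident)
  qed
  ultimately show ?thesis by simp
qed

lemma card_pairings:
  "finite X \<Longrightarrow> real (card (pairings X)) = std_moment (card X)"
proof (induction "card X" arbitrary: X rule: less_induct)
  case less
  show ?case
  proof (cases "X = {}")
    case True
    have "pairings X = {{}}" using True by (auto simp: pairings_def partition_on_empty)
    then show ?thesis by (simp add: True std_moment_def)
  next
    case False
    then obtain x where x: "x \<in> X" by blast
    have "card (X - {x, y}) = card X - 2" "card X \<ge> 2" if "y \<in> X - {x}" for y
      using that x less.prems card_mono[of X "{x, y}"] by (auto simp: card_Diff_subset)
    then have "real (card (pairings (X - {x, y}))) = std_moment (card X - 2)" if "y \<in> X - {x}" for y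
      using that less.hyps[of "X - {x, y}"] less.prems by fastforce
    then have "real (card (pairings X)) = real (card (X - {x})) * std_moment (card X - 2)"
      by (simp add: card_pairings_remove[OF less.prems x])
    also have "\<dots> = std_moment (card X)"
    \<comment> \<open>For one element the truncated \<open>card X - 2\<close> is 0 and
      \<open>std_moment 0 = 1\<close>, but the number of partners is 0, in agreement with the odd
      moment.\<close>
    proof (cases "card X = 1")
      case False
      then obtain m where "card X = Suc (Suc m)"
        using x less.prems by (metis One_nat_def card_eq_0_iff empty_iff old.nat.exhaust)
      then show ?thesis using x less.prems by (simp add: std_moment_Suc_Suc)
    qed (use x less.prems in \<open>simp add: std_moment_def\<close>)
    finally show ?thesis .
  qed
qed

section \<open>Evaluation at a value of the parameter as a ring homomorphism\<close>

lemma eval_lam_0 [simp]: "eval_lam 0 x = 0"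
  by (simp add: eval_lam_def)

lemma eval_lam_pCons [simp]: "eval_lam (pCons a p) x = of_rat a + x * eval_lam p x"
  by (simp add: eval_lam_def map_poly_pCons)

lemma eval_lam_add [simp]: "eval_lam (p + q) x = eval_lam p x + eval_lam q x"
  by (induction p q rule: poly_induct2) (simp_all add: of_rat_add algebra_simps)

lemma eval_lam_smult [simp]: "eval_lam (smult c p) x = of_rat c * eval_lam p x"
  by (induction p) (simp_all add: of_rat_mult algebra_simps)

lemma eval_lam_mult [simp]: "eval_lam (p * q) x = eval_lam p x * eval_lam q x"
  by (induction p) (simp_all add: algebra_simps)

lemma eval_lam_1 [simp]: "eval_lam 1 x = 1"
  by (simp add: one_pCons)

lemma eval_lam_sum: "eval_lam (\<Sum>i\<in>I. p i) x = (\<Sum>i\<in>I. eval_lam (p i) x)"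
  by (induction I rule: infinite_finite_induct) simp_all

lemma eval_lam_prod: "eval_lam (\<Prod>i\<in>I. p i) x = (\<Prod>i\<in>I. eval_lam (p i) x)"
  by (induction I rule: infinite_finite_induct) simp_all

section \<open>The graph sum as a Gaussian expectation\<close>

text \<open>The quotient guarantees only some member of Euler characteristic \<open>c\<close>, and
  \<open>repr C\<close> is an arbitrary choice. An isomorphism to such a member suffices later,
  since degrees and the number of vertices transfer.\<close>

lemma mem_edge_coloured_graphs:
  assumes "C \<in> edge_coloured_graphs c"
  shows "wf_cgraph (repr C)" "cgraph_rel `` {repr C} = C"
    and "\<exists>G :: (nat, 'c::finite) cgraph. wf_cgraph G \<and> euler_char G = c \<and> cgraph_isos (repr C) G \<noteq> {}"
proof -
  obtain G where G: "wf_cgraph G" "euler_char G = c" and C: "C = cgraph_rel `` {G}"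
    using assms by (auto simp: edge_coloured_graphs_def quotient_def)
  have "(G, G) \<in> cgraph_rel" using G(1) cgraph_isos_id by (auto simp: cgraph_rel_def)
  then have "G \<in> C" by (simp add: C)
  then have "repr C \<in> C" unfolding repr_def by (rule someI)
  then have GR: "(G, repr C) \<in> cgraph_rel" by (simp add: C)
  then show wfR: "wf_cgraph (repr C)" by (simp add: cgraph_rel_def)
  show "cgraph_rel `` {repr C} = C"
    using equiv_class_eq[OF equiv_cgraph_rel GR] C by simp
  show "\<exists>G :: (nat, 'c) cgraph. wf_cgraph G \<and> euler_char G = c \<and> cgraph_isos (repr C) G \<noteq> {}"
  proof -
    have "cgraph_isos (repr C) G \<noteq> {}"
      using cgraph_isos_sym[OF G(1) wfR] GR by (simp add: cgraph_rel_def)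
    then show ?thesis using G by blast
  qed
qed

lemma lookup_Abs_poly_mapping_finite:
  "Poly_Mapping.lookup (Abs_poly_mapping w) = (w :: 'c::finite \<Rightarrow> nat)"
  by (rule lookup_Abs_poly_mapping) simp

lemma Abs_poly_mapping_mem_keys:
  "Abs_poly_mapping w \<in> Poly_Mapping.keys V \<longleftrightarrow> w \<in> Poly_Mapping.lookup ` Poly_Mapping.keys V"
  for V :: "('c::finite) mvpoly"
proof
  assume "Abs_poly_mapping w \<in> Poly_Mapping.keys V"
  then have "Poly_Mapping.lookup (Abs_poly_mapping w) \<in> Poly_Mapping.lookup ` Poly_Mapping.keys V"
    by (rule imageI)
  then show "w \<in> Poly_Mapping.lookup ` Poly_Mapping.keys V"
    by (simp only: lookup_Abs_poly_mapping_finite)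
qed auto

lemma Lam_eq_0_iff:
  "Lam V w = 0 \<longleftrightarrow> w \<notin> Poly_Mapping.lookup ` Poly_Mapping.keys V" for V :: "('c::finite) mvpoly"
proof -
  have "of_nat (\<Prod>i\<in>UNIV. fact (w i)) \<noteq> (0 :: rat)"
    by (simp del: of_nat_prod)
  then have "Lam V w = 0 \<longleftrightarrow> Abs_poly_mapping w \<notin> Poly_Mapping.keys V"
    by (simp only: Lam_def smult_eq_0_iff) (simp add: in_keys_iff)
  then show ?thesis by (simp add: Abs_poly_mapping_mem_keys)
qed

section \<open>Graphs whose degrees are exponents of \<open>V\<close>\<close>

context
  fixes V :: "('c::finite) mvpoly" and k N n :: nat and W :: "('c \<Rightarrow> nat) set"
    and q :: "(nat \<Rightarrow> 'c \<Rightarrow> nat) \<Rightarrow> rat poly"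
  assumes k: "k \<ge> 3" and hom: "homogeneous k V" and Nk: "N * (k - 2) = 2 * n"
  defines "W \<equiv> Poly_Mapping.lookup ` Poly_Mapping.keys V"
    and "q \<equiv> \<lambda>f. \<Prod>a<N. Poly_Mapping.lookup V (Abs_poly_mapping (f a))"
begin

lemma sum_W: "w \<in> W \<Longrightarrow> (\<Sum>i\<in>UNIV. w i) = k"
  using hom by (auto simp: W_def homogeneous_def)

text \<open>Exponents add up to \<open>k\<close>, which is positive, so no standard vertex is the
  empty set.\<close>

lemma pos_W: "w \<in> W \<Longrightarrow> \<exists>i. 0 < w i"
  using sum_W[of w] k by (metis gr0I not_numeral_le_zero sum.neutral)

lemma finite_W: "finite W"
  by (simp add: W_def)

text \<open>Twice either Euler characteristic is a multiple of 2 - k, and \<open>k \<ge> 3\<close>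
  lets this factor cancel.\<close>

lemma euler_char_W:
  assumes "wf_cgraph G" "\<And>v. v \<in> verts G \<Longrightarrow> vdeg G v \<in> W"
  shows "euler_char G = - int n \<longleftrightarrow> card (verts G) = N"
proof -
  have "2 * euler_char G = (2 - int k) * int (card (verts G))"
    using assms sum_W by (intro euler_char_regular) auto
  moreover have "2 * int n = (int k - 2) * int N"
    using arg_cong[OF Nk, of int] k by (simp add: of_nat_diff mult.commute)
  ultimately have "euler_char G = - int n \<longleftrightarrow> (2 - int k) * int (card (verts G)) = (2 - int k) * int N"
    by (auto simp: algebra_simps)
  then show ?thesis using k by simp
qed

lemma wf_std_graph_W: "(f, E) \<in> std_graphs N W \<Longrightarrow> wf_cgraph (std_graph N f E)"
  by (rule wf_std_graphs) (auto intro: pos_W)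

lemma vdeg_std_graph:
  assumes "(f, E) \<in> std_graphs N W" "v \<in> verts (std_graph N f E)"
  shows "vdeg (std_graph N f E) v \<in> W"
  using assms std_graphsD(2)[OF assms(1)] by (auto simp: vdeg_std_vertex)

lemma prod_vdeg_std_graph:
  fixes h :: "('c \<Rightarrow> nat) \<Rightarrow> 'b::comm_monoid_mult"
  assumes "(f, E) \<in> std_graphs N W"
  shows "(\<Prod>v\<in>verts (std_graph N f E). h (vdeg (std_graph N f E) v)) = (\<Prod>a<N. h (f a))"
proof -
  have "inj_on (std_vertex f) {..<N}"
    using std_graphsD(2)[OF assms] pos_W by (intro inj_on_std_vertex) blast
  then show ?thesis by (simp add: prod.reindex vdeg_std_vertex)
qed

lemma vdeg_iso:
  assumes "wf_cgraph G" "wf_cgraph G'" "cgraph_isos G G' \<noteq> {}"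
    and "\<And>v. v \<in> verts G \<Longrightarrow> vdeg G v \<in> W" and v: "v \<in> verts G'"
  shows "vdeg G' v \<in> W"
proof -
  obtain j where j: "j \<in> cgraph_isos G G'" using assms(3) by blast
  then have "v \<in> vertex_map G j ` verts G"
    using v by (simp add: cgraph_isos_iff)
  then obtain u where u: "u \<in> verts G" "v = vertex_map G j u"
    by blast
  then show ?thesis using vdeg_vertex_map[OF assms(2) j, of u] assms(4) by simp
qed

text \<open>Orbit counting: each of the \<open>N! \<Prod>\<^sub>v deg(v)!\<close> labellings of \<open>G\<close> is an isomorphism from \<open>G\<close> to a
  unique standard graph, and each standard graph isomorphic to \<open>G\<close> is hit \<open>|Aut(G)|\<close> times.\<close>

lemma graph_weight_eq:
  assumes wf: "wf_cgraph G" and W: "\<And>v. v \<in> verts G \<Longrightarrow> vdeg G v \<in> W" and N: "card (verts G) = N"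
  defines "Y \<equiv> {y \<in> std_graphs N W. cgraph_isos G (case_prod (std_graph N) y) \<noteq> {}}"
  shows "graph_weight V G = (\<Sum>(f, E)\<in>Y. smult (1 / fact N) (q f))" "Y \<noteq> {}"
proof -
  define D where "D = (\<Prod>v\<in>verts G. \<Prod>i\<in>UNIV. fact (vdeg G v i) :: nat)"
  define Q where "Q = (\<Prod>v\<in>verts G. Poly_Mapping.lookup V (Abs_poly_mapping (vdeg G v)))"
  have "(\<Sum>(f, E)\<in>Y. cgraph_aut_card G) = (\<Sum>(f, E)\<in>Y. card (cgraph_isos G (std_graph N f E)))"
  proof (intro sum.cong refl, clarify)
    fix f E assume "(f, E) \<in> Y"
    then show "cgraph_aut_card G = card (cgraph_isos G (std_graph N f E))"
      using card_cgraph_isos[OF wf wf_std_graph_W, of f E] by (simp add: Y_def)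
  qed
  also have "\<dots> = (\<Sum>(f, E)\<in>std_graphs N W. card (cgraph_isos G (std_graph N f E)))"
    using finite_std_graphs[OF finite_W] by (intro sum.mono_neutral_left) (auto simp: Y_def)
  also have "\<dots> = fact N * D"
    unfolding D_def by (rule sum_card_isos_std_graphs[OF wf N finite_W pos_W W])
  finally have card: "card Y * cgraph_aut_card G = fact N * D" by simp
  \<comment> \<open>Positivity of the labelling count gives both an isomorphic standard graph and a
    nonzero number of automorphisms.\<close>
  have "D > 0" by (simp add: D_def prod_pos)
  then have "fact N * D \<noteq> 0" by simp
  then have nz: "card Y \<noteq> 0" "cgraph_aut_card G \<noteq> 0"
    unfolding card[symmetric] by simp_all
  then show "Y \<noteq> {}" by auto
  have "of_nat (card Y) * of_nat (cgraph_aut_card G) = (fact N * of_nat D :: rat)"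
    using arg_cong[OF card, of "of_nat :: nat \<Rightarrow> rat"] by simp
  then have ratio: "of_nat D / of_nat (cgraph_aut_card G) = (of_nat (card Y) / fact N :: rat)"
    using nz by (simp add: field_simps)
  \<comment> \<open>\<open>D\<close> collects the factorials of \<open>Lam\<close> and leaves bare
    coefficients in \<open>Q\<close>. By the count, D/|Aut(G)| = |Y|/N!, which spreads the weight
    evenly over \<open>Y\<close>.\<close>
  have "graph_weight V G = smult (1 / of_nat (cgraph_aut_card G)) (smult (of_nat D) Q)"
    by (simp add: graph_weight_def Lam_def prod_smult D_def Q_def)
  also have "\<dots> = smult (of_nat (card Y) / fact N) Q"
    using ratio by simp
  also have "\<dots> = (\<Sum>(f, E)\<in>Y. smult (1 / fact N) Q)"
    by (simp add: case_prod_unfold of_nat_poly mult.commute[of _ "smult _ _"])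
  also have "\<dots> = (\<Sum>(f, E)\<in>Y. smult (1 / fact N) (q f))"
  proof (intro sum.cong refl, clarify)
    fix f E assume "(f, E) \<in> Y"
    then obtain j where y: "(f, E) \<in> std_graphs N W" and j: "j \<in> cgraph_isos G (std_graph N f E)"
      by (auto simp: Y_def)
    have "Q = q f"
      unfolding Q_def q_def
      using prod_vdeg_iso[OF wf wf_std_graph_W[OF y] j, of "\<lambda>w. Poly_Mapping.lookup V (Abs_poly_mapping w)"]
        prod_vdeg_std_graph[OF y, of "\<lambda>w. Poly_Mapping.lookup V (Abs_poly_mapping w)"] by simp
    then show "smult (1 / fact N) Q = smult (1 / fact N) (q f)" by simp
  qed
  finally show "graph_weight V G = (\<Sum>(f, E)\<in>Y. smult (1 / fact N) (q f))" .
qed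

text \<open>The identity is one of finitely many automorphisms, so the prefactor is nonzero, and
  rational polynomials have no zero divisors.\<close>

lemma graph_weight_nonzero_iff:
  assumes "wf_cgraph G"
  shows "graph_weight V G \<noteq> 0 \<longleftrightarrow> (\<forall>v\<in>verts G. vdeg G v \<in> W)"
proof -
  have "(\<lambda>i. restrict id (half_edges G i)) \<in> cgraph_isos G G"
    by (rule cgraph_isos_id[OF assms])
  then have "cgraph_aut_card G \<noteq> 0"
    unfolding cgraph_aut_card_def using finite_cgraph_isos[OF assms assms] by auto
  then show ?thesis
    by (auto simp: graph_weight_def Lam_eq_0_iff W_def wf_cgraphD(9)[OF assms])
qed

text \<open>Standard graphs are sorted by isomorphism class; the fibre over a class is the set
  \<open>Y\<close> of \<open>graph_weight_eq\<close>, whose sum is the weight of that class.\<close>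

lemma A_poly_eq_sum_std_graphs: "A_poly n V = (\<Sum>(f, E)\<in>std_graphs N W. smult (1 / fact N) (q f))"
proof -
  define Cl where "Cl = {C \<in> edge_coloured_graphs (- int n). graph_weight V (repr C) \<noteq> 0}"
  define Y where "Y G = {y \<in> std_graphs N W. cgraph_isos G (case_prod (std_graph N) y) \<noteq> {}}"
    for G :: "(nat, 'c) cgraph"
  have R: "wf_cgraph (repr C)" "\<And>v. v \<in> verts (repr C) \<Longrightarrow> vdeg (repr C) v \<in> W"
    "card (verts (repr C)) = N" if "C \<in> Cl" for C
  proof -
    have C: "C \<in> edge_coloured_graphs (- int n)" "graph_weight V (repr C) \<noteq> 0"
      using that by (auto simp: Cl_def)
    note * = mem_edge_coloured_graphs[OF C(1)]
    show wf: "wf_cgraph (repr C)" by fact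
    show deg: "vdeg (repr C) v \<in> W" if "v \<in> verts (repr C)" for v
      using graph_weight_nonzero_iff[OF wf] C(2) that by blast
    obtain G :: "(nat, 'c) cgraph" where G: "wf_cgraph G" "euler_char G = - int n" "cgraph_isos (repr C) G \<noteq> {}"
      using *(3) by blast
    then obtain j where j: "j \<in> cgraph_isos (repr C) G" by blast
    have "card (verts G) = N"
      using euler_char_W[OF G(1)] vdeg_iso[OF wf G(1,3) deg] G(2) by blast
    moreover have "card (verts G) = card (verts (repr C))"
      using j card_image[OF inj_on_vertex_map[OF wf G(1) j]] by (simp add: cgraph_isos_iff)
    ultimately show "card (verts (repr C)) = N" by simp
  qed
  \<comment> \<open>Codes structured labels as natural numbers, so that each standard graph has an
    isomorphic copy \<open>\<rho> y\<close> among the graphs that form classes.\<close>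
  obtain \<iota> :: "nat \<times> 'c \<times> nat \<Rightarrow> nat" where \<iota>: "inj \<iota>"
  proof -
    obtain c :: "'c \<Rightarrow> nat" where c: "inj c"
      using finite_imp_inj_to_nat_seg[of "UNIV :: 'c set"] by auto
    have "inj (\<lambda>(a, i, l). prod_encode (a, prod_encode (c i, l)))"
      using c by (auto simp: inj_def)
    then show ?thesis by (rule that)
  qed
  have wfS: "wf_cgraph (case_prod (std_graph N) y)" if "y \<in> std_graphs N W" for y
    using that wf_std_graph_W by (cases y) simp
  have "\<exists>G :: (nat, 'c) cgraph. wf_cgraph G \<and> cgraph_isos (case_prod (std_graph N) y) G \<noteq> {}"
    if "y \<in> std_graphs N W" for y
    using cgraph_relabel[OF wfS[OF that] \<iota>] by blast
  then obtain \<rho> :: "_ \<Rightarrow> (nat, 'c) cgraph" where \<rho>: "wf_cgraph (\<rho> y)"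
      "cgraph_isos (case_prod (std_graph N) y) (\<rho> y) \<noteq> {}" if "y \<in> std_graphs N W" for y
    by metis
  define cls where "cls y = cgraph_rel `` {\<rho> y}" for y
  have cls_eq: "cls y = C \<longleftrightarrow> cgraph_isos (repr C) (case_prod (std_graph N) y) \<noteq> {}"
    if y: "y \<in> std_graphs N W" and C: "C \<in> edge_coloured_graphs c" for y C c
  proof -
    note * = mem_edge_coloured_graphs[OF C]
    have "cls y = C \<longleftrightarrow> cgraph_rel `` {\<rho> y} = cgraph_rel `` {repr C}"
      using *(2) by (simp add: cls_def)
    also have "\<dots> \<longleftrightarrow> (\<rho> y, repr C) \<in> cgraph_rel"
      using equiv_class_eq_iff[OF equiv_cgraph_rel, of "\<rho> y" "repr C"] \<rho>(1)[OF y] *(1) by auto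
    also have "\<dots> \<longleftrightarrow> cgraph_isos (\<rho> y) (repr C) \<noteq> {}"
      using \<rho>(1)[OF y] *(1) by (simp add: cgraph_rel_def)
    also have "\<dots> \<longleftrightarrow> cgraph_isos (repr C) (case_prod (std_graph N) y) \<noteq> {}"
    proof
      assume "cgraph_isos (\<rho> y) (repr C) \<noteq> {}"
      then have "cgraph_isos (case_prod (std_graph N) y) (repr C) \<noteq> {}"
        by (rule cgraph_isos_trans[OF wfS[OF y] \<rho>(1)[OF y] \<rho>(2)[OF y]])
      then show "cgraph_isos (repr C) (case_prod (std_graph N) y) \<noteq> {}"
        by (rule cgraph_isos_sym[OF wfS[OF y] *(1)])
    next
      assume "cgraph_isos (repr C) (case_prod (std_graph N) y) \<noteq> {}"
      then have "cgraph_isos (repr C) (\<rho> y) \<noteq> {}"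
        using \<rho>(2)[OF y] by (rule cgraph_isos_trans[OF *(1) wfS[OF y]])
      then show "cgraph_isos (\<rho> y) (repr C) \<noteq> {}"
        by (rule cgraph_isos_sym[OF *(1) \<rho>(1)[OF y]])
    qed
    finally show ?thesis .
  qed
  have cls_Cl: "cls y \<in> Cl" if y: "y \<in> std_graphs N W" for y
  proof -
    obtain f E where fE: "y = (f, E)" by (cases y)
    have degS: "vdeg (case_prod (std_graph N) y) v \<in> W" if "v \<in> verts (case_prod (std_graph N) y)" for v
      using vdeg_std_graph y that by (simp add: fE)
    have deg: "vdeg (\<rho> y) v \<in> W" if "v \<in> verts (\<rho> y)" for v
      by (rule vdeg_iso[OF wfS[OF y] \<rho>[OF y] degS that])
    obtain j where j: "j \<in> cgraph_isos (case_prod (std_graph N) y) (\<rho> y)" using \<rho>(2)[OF y] by blast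
    have "inj_on (std_vertex f) {..<N}"
      using std_graphsD(2) y pos_W unfolding fE by (intro inj_on_std_vertex) blast
    then have "card (verts (case_prod (std_graph N) y)) = N"
      by (simp add: fE card_image)
    moreover have "card (verts (\<rho> y)) = card (verts (case_prod (std_graph N) y))"
      using j card_image[OF inj_on_vertex_map[OF wfS[OF y] \<rho>(1)[OF y] j]]
      unfolding cgraph_isos_iff by metis
    ultimately have "euler_char (\<rho> y) = - int n"
      using euler_char_W[OF \<rho>(1)[OF y] deg] by simp
    then have C: "cls y \<in> edge_coloured_graphs (- int n)"
      using \<rho>(1)[OF y] by (auto simp: edge_coloured_graphs_def cls_def intro!: quotientI)
    have "cgraph_isos (repr (cls y)) (case_prod (std_graph N) y) \<noteq> {}"
      using cls_eq[OF y C] by simp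
    then have "cgraph_isos (case_prod (std_graph N) y) (repr (cls y)) \<noteq> {}"
      by (rule cgraph_isos_sym[OF mem_edge_coloured_graphs(1)[OF C] wfS[OF y]])
    then have "vdeg (repr (cls y)) v \<in> W" if "v \<in> verts (repr (cls y))" for v
      using vdeg_iso[OF wfS[OF y] mem_edge_coloured_graphs(1)[OF C] _ degS] that by blast
    then have "graph_weight V (repr (cls y)) \<noteq> 0"
      using graph_weight_nonzero_iff[OF mem_edge_coloured_graphs(1)[OF C]] by blast
    with C show ?thesis by (simp add: Cl_def)
  qed
  have fibre: "{y \<in> std_graphs N W. cls y = C} = Y (repr C)" if "C \<in> Cl" for C
    using cls_eq[of _ C] that by (auto simp: Y_def Cl_def)
  \<comment> \<open>In particular \<open>Cl\<close> is finite, so the sum in \<open>A_poly\<close>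
    is not the default 0 of a sum over an infinite set.\<close>
  have "cls ` std_graphs N W = Cl"
  proof (intro equalityI subsetI)
    fix C assume C: "C \<in> Cl"
    have "Y (repr C) \<noteq> {}" unfolding Y_def by (rule graph_weight_eq(2)[OF R[OF C]])
    then show "C \<in> cls ` std_graphs N W" using fibre[OF C] by blast
  qed (use cls_Cl in auto)
  then have "(\<Sum>(f, E)\<in>std_graphs N W. smult (1 / fact N) (q f)) =
      (\<Sum>C\<in>Cl. \<Sum>(f, E)\<in>{y \<in> std_graphs N W. cls y = C}. smult (1 / fact N) (q f))"
    using sum.image_gen[OF finite_std_graphs[OF finite_W], of _ N cls] by simp
  also have "\<dots> = (\<Sum>C\<in>Cl. graph_weight V (repr C))"
    using fibre graph_weight_eq(1)[OF R] by (intro sum.cong refl) (simp add: Y_def)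
  finally show ?thesis by (simp add: A_poly_def Cl_def)
qed

text \<open>The weight of a standard graph depends on \<open>f\<close> only, so summing over
  \<open>E\<close> just counts the pairings of each colour class.\<close>

lemma eval_A_poly:
  "eval_lam (A_poly n V) lam = (\<Sum>f\<in>{..<N} \<rightarrow>\<^sub>E W.
     (\<Prod>a<N. eval_lam (Poly_Mapping.lookup V (Abs_poly_mapping (f a))) lam) *
     (\<Prod>i\<in>UNIV. std_moment (\<Sum>a<N. f a i))) / fact N"
proof -
  have "eval_lam (A_poly n V) lam = (\<Sum>(f, E)\<in>std_graphs N W. eval_lam (q f) lam / fact N)"
  proof -
    have "of_rat (fact N) = (fact N :: real)"
      by (metis of_nat_fact of_rat_of_nat_eq)
    then show ?thesis
      unfolding A_poly_eq_sum_std_graphs eval_lam_sum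
      by (intro sum.cong refl) (auto simp: of_rat_divide)
  qed
  also have "\<dots> = (\<Sum>f\<in>{..<N} \<rightarrow>\<^sub>E W.
      \<Sum>E\<in>(\<Pi>\<^sub>E i\<in>UNIV. pairings (std_half N f i)). eval_lam (q f) lam / fact N)"
    unfolding std_graphs_def
  proof (rule sum.Sigma[symmetric])
    show "finite ({..<N} \<rightarrow>\<^sub>E W)"
      by (intro finite_PiE) (simp_all add: finite_W)
    show "\<forall>f\<in>{..<N} \<rightarrow>\<^sub>E W. finite (\<Pi>\<^sub>E i\<in>UNIV. pairings (std_half N f i))"
      by (intro ballI finite_PiE) (simp_all add: finite_pairings finite_std_half)
  qed
  also have "\<dots> = (\<Sum>f\<in>{..<N} \<rightarrow>\<^sub>E W.
      eval_lam (q f) lam * (\<Prod>i\<in>UNIV. std_moment (\<Sum>a<N. f a i)) / fact N)"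
    by (intro sum.cong refl)
       (simp add: card_PiE card_pairings finite_std_half card_std_half mult.commute)
  finally show ?thesis
    by (simp add: q_def eval_lam_prod sum_divide_distrib)
qed

text \<open>Multiplying out chooses a monomial in each of the \<open>N\<close> factors, which is the
  index set of \<open>eval_A_poly\<close>.\<close>

lemma eval_mvpoly_power:
  "eval_mvpoly V x lam ^ N = (\<Sum>f\<in>{..<N} \<rightarrow>\<^sub>E W.
     (\<Prod>a<N. eval_lam (Poly_Mapping.lookup V (Abs_poly_mapping (f a))) lam) *
     (\<Prod>i\<in>UNIV. (x $ i) ^ (\<Sum>a<N. f a i)))"
proof -
  let ?c = "\<lambda>w. eval_lam (Poly_Mapping.lookup V (Abs_poly_mapping w)) lam"
  have "eval_mvpoly V x lam = (\<Sum>w\<in>W. ?c w * (\<Prod>i\<in>UNIV. (x $ i) ^ w i))"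
    unfolding eval_mvpoly_def W_def
    by (subst sum.reindex) (auto simp: inj_on_def poly_mapping_eqI lookup_inverse)
  then have "eval_mvpoly V x lam ^ N = (\<Prod>a<N. \<Sum>w\<in>W. ?c w * (\<Prod>i\<in>UNIV. (x $ i) ^ w i))"
    by simp
  also have "\<dots> = (\<Sum>f\<in>{..<N} \<rightarrow>\<^sub>E W. \<Prod>a<N. ?c (f a) * (\<Prod>i\<in>UNIV. (x $ i) ^ f a i))"
    by (rule prod_sum_PiE) (auto simp: finite_W)
  also have "\<dots> = (\<Sum>f\<in>{..<N} \<rightarrow>\<^sub>E W. (\<Prod>a<N. ?c (f a)) * (\<Prod>i\<in>UNIV. (x $ i) ^ (\<Sum>a<N. f a i)))"
    by (intro sum.cong refl) (subst power_sum, subst prod.swap, simp add: prod.distrib)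
  finally show ?thesis .
qed

text \<open>Every monomial of the power has degree kN, so one radial factor, at z = (kN + d)/2,
  serves all terms and leaves the sum.\<close>

lemma integral_eval_mvpoly_power:
  defines "z \<equiv> real N + real n + real CARD('c) / 2"
  shows "(\<integral>x. eval_mvpoly V x lam ^ N \<partial>(sphere_measure :: (real ^ 'c) measure)) * (2 powr (z - 1) * Gamma z) =
    (2 * pi) powr (real CARD('c) / 2) * (fact N * eval_lam (A_poly n V) lam)"
proof -
  let ?c = "\<lambda>f. \<Prod>a<N. eval_lam (Poly_Mapping.lookup V (Abs_poly_mapping (f a))) lam"
  let ?m = "\<lambda>f i. \<Sum>a<N. f a i"
  have "k * N = 2 * (N + n)"
  proof -
    obtain l where "k = l + 2" using k that[of "k - 2"] by simp
    then show ?thesis using Nk by (simp add: algebra_simps)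
  qed
  have z: "(real (\<Sum>i\<in>UNIV. ?m f i) + real CARD('c)) / 2 = z" if "f \<in> {..<N} \<rightarrow>\<^sub>E W" for f
  proof -
    have "(\<Sum>i\<in>UNIV. ?m f i) = (\<Sum>a<N. \<Sum>i\<in>UNIV. f a i)" by (rule sum.swap)
    also have "\<dots> = (\<Sum>a<N. k)" using that sum_W by (intro sum.cong refl) auto
    also have "\<dots> = 2 * (N + n)" using \<open>k * N = 2 * (N + n)\<close> by (simp add: mult.commute)
    finally show ?thesis by (simp only: z_def) simp
  qed
  have mono: "(\<integral>x. (\<Prod>i\<in>UNIV. (x $ i) ^ ?m f i) \<partial>(sphere_measure :: (real ^ 'c) measure)) * (2 powr (z - 1) * Gamma z) =
      (2 * pi) powr (real CARD('c) / 2) * (\<Prod>i\<in>UNIV. std_moment (?m f i))" if "f \<in> {..<N} \<rightarrow>\<^sub>E W" for f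
    using integral_sphere_monomial[of "?m f"] unfolding z[OF that] .
  have "(\<integral>x. eval_mvpoly V x lam ^ N \<partial>(sphere_measure :: (real ^ 'c) measure)) =
     (\<Sum>f\<in>{..<N} \<rightarrow>\<^sub>E W. ?c f * (\<integral>x. (\<Prod>i\<in>UNIV. (x $ i) ^ ?m f i) \<partial>(sphere_measure :: (real ^ 'c) measure)))"
    unfolding eval_mvpoly_power
    by (subst Bochner_Integration.integral_sum) (auto intro: integrable_sphere_monomial)
  then have "(\<integral>x. eval_mvpoly V x lam ^ N \<partial>(sphere_measure :: (real ^ 'c) measure)) * (2 powr (z - 1) * Gamma z) =
     (\<Sum>f\<in>{..<N} \<rightarrow>\<^sub>E W. ?c f * ((2 * pi) powr (real CARD('c) / 2) * (\<Prod>i\<in>UNIV. std_moment (?m f i))))"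
    unfolding sum_distrib_right mult.assoc by (simp add: sum_distrib_right mult.assoc mono cong: sum.cong)
  also have "\<dots> = (2 * pi) powr (real CARD('c) / 2) *
      (\<Sum>f\<in>{..<N} \<rightarrow>\<^sub>E W. ?c f * (\<Prod>i\<in>UNIV. std_moment (?m f i)))"
    by (simp add: sum_distrib_left mult_ac)
  also have "(\<Sum>f\<in>{..<N} \<rightarrow>\<^sub>E W. ?c f * (\<Prod>i\<in>UNIV. std_moment (?m f i))) = fact N * eval_lam (A_poly n V) lam"
    by (simp add: eval_A_poly)
  finally show ?thesis .
qed

end

theorem proposition2p6:
  fixes V :: "('c::finite) mvpoly" and k n :: nat and M K lam d :: real
  assumes "k \<ge> 3"
    and "homogeneous k V"
    and "M = real k / (real k - 2)"
    and "K = 2 / (real k - 2)"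
    and "d = real CARD('c)"
    and "real n * K \<in> \<int>"
    and "real n * M \<in> \<int>"
  shows "eval_lam (A_poly n V) lam =
           2 powr (real n * M + (d - 2) / 2) * gamma_fact (real n * M + (d - 2) / 2)
             / ((2 * pi) powr (d / 2) * gamma_fact (real n * K))
           * (\<integral>x. eval_mvpoly V x lam ^ nat \<lfloor>real n * K\<rfloor> \<partial>(sphere_measure :: (real ^ 'c) measure))"
proof -
  have k: "real k - 2 > 0" using assms(1) by simp
  then have "real n * K \<ge> 0" by (simp add: assms(4))
  then obtain N :: nat where N: "real n * K = real N"
    using assms(6) by (metis Ints_cases of_int_0_le_iff of_int_of_nat_eq zero_le_imp_eq_int)
  then have "real N * (real k - 2) = 2 * real n" using k by (simp add: assms(4) field_simps)
  then have "real (N * (k - 2)) = real (2 * n)" using assms(1) by (simp add: of_nat_diff)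
  then have Nk: "N * (k - 2) = 2 * n" by (simp only: of_nat_eq_iff)
  \<comment> \<open>Hence nM = N + n and nM + (d - 2)/2 = z - 1; the shift in
    \<open>gamma_fact\<close> then gives Gamma at \<open>z\<close>.\<close>
  have "M = K + 1" using k by (simp add: assms(3,4) field_simps)
  define z where "z = real N + real n + real CARD('c) / 2"
  have nM: "real n * M + (d - 2) / 2 = z - 1"
    unfolding \<open>M = K + 1\<close> distrib_left N z_def assms(5) by (simp add: diff_divide_distrib)
  have "(2 * pi) powr (d / 2) > 0" by simp
  moreover have "gamma_fact (real N) = fact N"
    by (simp add: gamma_fact_def Gamma_fact add.commute)
  moreover have "gamma_fact (z - 1) = Gamma z" by (simp add: gamma_fact_def)
  moreover note integral_eval_mvpoly_power[OF assms(1,2) Nk, of lam, folded z_def]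
  ultimately show ?thesis
    unfolding nM N assms(5)[symmetric] by (simp add: field_simps)
qed

end
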